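(* Let $\mathbb{F}_q$ be a fixed finite field with $q$ odd and $q\equiv 1\pmod 4$. Then, as $g\to\infty$, $$\sum_{\substack{P \text{ monic irreducible}\\ \deg P=2g+1}}L(\tfrac12,\chi_P)^2=\frac{1}{24}\,\frac{1}{\zeta_A(2)}\,|P|(\log_q|P|)^2+O\big(|P|\log_q|P|\big),$$ where on the right-hand side $|P|=q^{2g+1}$, $\log_q|P|=2g+1$, and $\zeta_A(2)=\frac{1}{1-q^{-1}}$.
   Context: $A=\mathbb{F}_q[T]$. For nonzero $f\in A$, $|f|=q^{\deg f}$. $\zeta_A(s)=\sum_{f\in A\text{ monic}}|f|^{-s}=\frac{1}{1-q^{1-s}}$. For a monic irreducible $Q\in A$ and $a\in A$, $\left(\frac{a}{Q}\right)$ equals $0$ if $Q\mid a$, $1$ if $a$ is a nonzero square modulo $Q$, and $-1$ otherwise; for monic $f=\prod_i Q_i^{e_i}$ one sets $\left(\frac{a}{f}\right)=\prod_i\left(\frac{a}{Q_i}\right)^{e_i}$, with $\left(\frac{a}{1}\right)=1$. For a monic irreducible $P$, $\chi_P(f)=\left(\frac{P}{f}\right)$ for monic $f$. For $P$ monic irreducible of odd degree $2g+1$, $L(s,\chi_P)=\sum_{f\text{ monic}}\chi_P(f)|f|^{-s}$ ($\Re s>1$) is a polynomial in $u=q^{-s}$ of degree $2g$, and $L(\tfrac12,\chi_P)$ denotes its value at $u=q^{-1/2}$. Implied constants may depend on $q$. *)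

theory Defs
  imports "HOL-Analysis.Analysis" "HOL-Computational_Algebra.Computational_Algebra"
    "HOL-Library.Landau_Symbols"
begin

definition qr_symbol :: "'a::{finite,field_gcd} poly \<Rightarrow> 'a poly \<Rightarrow> int" where
  "qr_symbol a Q =
     (if Q dvd a then 0
      else if (\<exists>b. Q dvd (b ^ 2 - a)) then 1 else -1)"

definition jacobi_symbol :: "'a::{finite,field_gcd} poly \<Rightarrow> 'a poly \<Rightarrow> int" where
  "jacobi_symbol a f = prod_mset (image_mset (qr_symbol a) (prime_factorization f))"

definition chi :: "'a::{finite,field_gcd} poly \<Rightarrow> 'a poly \<Rightarrow> int" where
  "chi P f = jacobi_symbol P f"

definition monic_of_degree :: "nat \<Rightarrow> 'a::{finite,field_gcd} poly set" where
  "monic_of_degree n = {f. lead_coeff f = 1 \<and> degree f = n}"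

text \<open>Coefficient of u^n in L(s,chi_P) as a power series in u = q^(-s).\<close>
definition L_coeff :: "'a::{finite,field_gcd} poly \<Rightarrow> nat \<Rightarrow> real" where
  "L_coeff P n = (\<Sum>f\<in>monic_of_degree n. real_of_int (chi P f))"

text \<open>L(1/2, chi_P): the polynomial in u evaluated at u = q^(-1/2).\<close>
definition L_half :: "'a::{finite,field_gcd} poly \<Rightarrow> real" where
  "L_half P = (\<Sum>n. L_coeff P n * (real CARD('a)) powr (- real n / 2))"

definition zeta_A :: "nat \<Rightarrow> real \<Rightarrow> real" where
  "zeta_A q s = 1 / (1 - real q powr (1 - s))"

definition monic_irreducibles_of_degree :: "nat \<Rightarrow> 'a::{finite,field_gcd} poly set" where
  "monic_irreducibles_of_degree n = {P. lead_coeff P = 1 \<and> irreducible P \<and> degree P = n}"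

end

theory Submission
  imports "HOL-Algebra.Algebraic_Closure_Type" Defs
begin

text \<open>
  Write \<open>q\<close> for the size of the field and \<open>N = 2g + 1\<close>. Quadratic reciprocity (\<open>q\<close> is 1 modulo 4) turns
  \<open>\<chi>\<^sub>P(f)\<close> into the residue symbol of \<open>f\<close> modulo \<open>P\<close>. The functional equation of \<open>L(s, \<chi>\<^sub>P)\<close>, needed only
  up to sign because the \<open>L\<close>-value is squared, expresses \<open>L(1/2, \<chi>\<^sub>P)\<^sup>2\<close> as a sum over pairs
  \<open>(f\<^sub>1, f\<^sub>2)\<close> of monic polynomials of total degree at most \<open>2g\<close>.

  If \<open>f = f\<^sub>1 f\<^sub>2\<close> is not a square, then the symbols of \<open>f\<close> modulo the primes \<open>P\<close> of degree \<open>N\<close> sum to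
  \<open>O(q\<^bsup>g+1\<^esup>)\<close>. This is the Riemann hypothesis for hyperelliptic curves in the only form that is
  required; it is proved by Stepanov's method, by constructing one nonzero polynomial of degree about
  \<open>q\<^sup>N / 2\<close> that is divisible by every \<open>P\<close> at which \<open>f\<close> has a prescribed nonzero symbol. The pairs whose
  product is a square are counted exactly, through \<open>(f\<^sub>1, f\<^sub>2) = (h u\<^sup>2, h v\<^sup>2)\<close> with coprime \<open>u\<close> and \<open>v\<close>,
  and give the main term.
\<close>

hide_const (open) Divisibility.prime Divisibility.irreducible

section \<open>Evaluation in the algebraic closure of a finite field\<close>

text \<open>The error term leaves no room to spare. There are about \<open>k q^k\<close> pairs of
  total degree \<open>k\<close>, weighted by \<open>q^(-k/2)\<close>, so a bound of size
  \<open>q^(g+1)\<close> for each nonsquare prime sum gives just \<open>|P| log |P|\<close> if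
  \<open>k\<close> stops at \<open>2g\<close>. Pairs up to total degree \<open>4g\<close> would be
  too many, hence the functional equation. Nor may the prime sum lose a factor \<open>g\<close>: the
  degree of \<open>f\<close> in Stepanov's bound has to be cancelled by the degree
  \<open>2g + 1\<close> of the primes that are counted. Upper bounds for both symbol values suffice,
  because the two classes exhaust the primes, whose number is known precisely enough. The constant
  1/24: total degree \<open>2j\<close> carries about \<open>(1 - 1/q) (j^2 / 2) q^j\<close> square
  pairs; twice their weighted sum over \<open>j <= g\<close> is about
  \<open>(1 - 1/q) g^3 / 3\<close>, that is \<open>(1 - 1/q) (2g + 1)^3 / 24\<close>, and there are
  about \<open>q^(2g+1) / (2g + 1)\<close> primes. Residue fields are not formed as quotients. All
  of them are found inside one algebraic closure, where roots of different primes can be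
  compared.\<close>

definition ev :: "'a::field poly \<Rightarrow> 'a alg_closure \<Rightarrow> 'a alg_closure" where
  "ev h x = poly (map_poly to_ac h) x"

lemma ev_simps [simp]:
  "ev 0 x = 0" "ev 1 x = 1" "ev (pCons a h) x = to_ac a + x * ev h x"
  by (simp_all add: ev_def map_poly_pCons)

lemma ev_add [simp]: "ev (g + h) x = ev g x + ev h x"
proof (induction g arbitrary: h)
  case (pCons a g)
  note IH = pCons.IH
  show ?case
  proof (cases h)
    case (pCons b h')
    show ?thesis using IH[of h'] unfolding pCons by (simp add: algebra_simps)
  qed
qed simp

lemma ev_smult [simp]: "ev (smult c h) x = to_ac c * ev h x"
  by (induction h) (simp_all add: algebra_simps)

lemma ev_minus [simp]: "ev (- h) x = - ev h x"
  by (induction h) (simp_all add: algebra_simps)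

lemma ev_diff [simp]: "ev (g - h) x = ev g x - ev h x"
  using ev_add[of g "- h" x] by simp

lemma ev_mult [simp]: "ev (g * h) x = ev g x * ev h x"
  by (induction g) (simp_all add: algebra_simps)

lemma ev_power [simp]: "ev (h ^ n) x = ev h x ^ n"
  by (induction n) simp_all

lemma ev_sum: "ev (sum f A) x = (\<Sum>i\<in>A. ev (f i) x)"
  by (induction A rule: infinite_finite_induct) simp_all

lemma ev_monom [simp]: "ev (monom 1 n) x = x ^ n"
  by (induction n) (simp_all add: monom_Suc)

section \<open>The Frobenius map over a finite field\<close>

lemma finite_field_power_card:
  fixes x :: "'a::{finite,field}"
  shows "x ^ CARD('a) = x"
proof (cases "x = 0")
  case False
  have "x * (\<Prod>y\<in>UNIV-{0}. x * y) = x * x ^ (CARD('a) - 1) * \<Prod>(UNIV-{0})"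
    by (simp add: prod.distrib mult_ac)
  also have "x * x ^ (CARD('a) - 1) = x ^ CARD('a)"
    by (metis Suc_diff_1 power_Suc zero_less_card_finite)
  also have "(\<Prod>y\<in>UNIV-{0}. x * y) = (\<Prod>y\<in>UNIV-{0}. y)"
    by (rule prod.reindex_bij_witness[of _ "\<lambda>y. y / x" "\<lambda>y. x * y"]) (use False in auto)
  finally show ?thesis
    by simp
qed simp

text \<open>
  \<open>(X + 1)\<^sup>q - X\<^sup>q - 1\<close> vanishes on the whole field and has degree below \<open>q\<close>. This gives the additivity
  of the \<open>q\<close>-th power map without knowing that \<open>q\<close> is a power of the characteristic.
\<close>

lemma of_nat_choose_card:
  assumes "0 < k" "k < CARD('a::{finite,field})"
  shows "of_nat (CARD('a) choose k) = (0::'a)"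
proof -
  define q where "q = CARD('a)"
  define p :: "'a poly" where "p = [:1, 1:] ^ q - monom 1 q - 1"
  have "q > 0" by (simp add: q_def)
  have c: "coeff p i = (if i = q then 0 else if i = 0 then 0 else of_nat (q choose i))" for i
  proof (cases "i \<le> q")
    case True
    then show ?thesis
      using \<open>q > 0\<close> by (auto simp: p_def coeff_linear_poly_power)
  next
    case False
    then have "coeff ([:1, 1::'a:] ^ q) i = 0"
      by (intro coeff_eq_0) (simp add: degree_linear_power)
    then show ?thesis
      using False \<open>q > 0\<close> by (simp add: p_def binomial_eq_0)
  qed
  have "degree p < q"
  proof -
    have "degree p \<le> q" by (rule degree_le) (auto simp: c binomial_eq_0)
    moreover have "degree p \<noteq> q"
    proof
      assume "degree p = q"
      then have "lead_coeff p = 0" by (simp add: c)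
      then show False using \<open>degree p = q\<close> \<open>q > 0\<close> by (metis degree_0 leading_coeff_0_iff not_less0)
    qed
    ultimately show ?thesis by simp
  qed
  moreover have "poly p x = 0" for x
    by (simp add: p_def q_def poly_monom finite_field_power_card)
  ultimately have "p = 0"
    using card_poly_roots_bound[of p] by (auto simp: q_def)
  then show ?thesis using c[of k] assms by (simp add: q_def)
qed

lemma freshmans_dream_choose:
  fixes x y :: "'b::comm_semiring_1"
  assumes "\<And>k. 0 < k \<Longrightarrow> k < n \<Longrightarrow> of_nat (n choose k) = (0::'b)" and "n > 0"
  shows "(x + y) ^ n = x ^ n + y ^ n"
proof -
  have "(x + y) ^ n = (\<Sum>k\<le>n. of_nat (n choose k) * x ^ k * y ^ (n - k))"
    by (rule binomial_ring)
  also have "\<dots> = (\<Sum>k\<in>{0,n}. of_nat (n choose k) * x ^ k * y ^ (n - k))"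
    by (intro sum.mono_neutral_right) (auto simp: assms)
  finally show ?thesis
    using \<open>n > 0\<close> by (simp add: add_ac)
qed

lemma power_card_add_ac:
  fixes x y :: "'a::{finite,field} alg_closure"
  shows "(x + y) ^ (CARD('a) ^ m) = x ^ (CARD('a) ^ m) + y ^ (CARD('a) ^ m)"
proof (induction m)
  case (Suc m)
  have "of_nat (CARD('a) choose k) = (0::'a alg_closure)" if "0 < k" "k < CARD('a)" for k
    using of_nat_choose_card[where 'a='a, OF that] by (metis to_ac_0 to_ac_of_nat)
  then have *: "(u + v) ^ CARD('a) = u ^ CARD('a) + v ^ CARD('a)" for u v :: "'a alg_closure"
    by (intro freshmans_dream_choose) auto
  show ?case
    by (simp add: power_mult mult.commute[of "CARD('a)"] Suc.IH *)
qed simp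

lemma power_card_add_poly:
  fixes x y :: "'a::{finite,field} poly"
  shows "(x + y) ^ (CARD('a) ^ m) = x ^ (CARD('a) ^ m) + y ^ (CARD('a) ^ m)"
proof (induction m)
  case (Suc m)
  have "of_nat (CARD('a) choose k) = (0::'a poly)" if "0 < k" "k < CARD('a)" for k
    using of_nat_choose_card[where 'a='a, OF that] by (simp add: of_nat_poly)
  then have *: "(u + v) ^ CARD('a) = u ^ CARD('a) + v ^ CARD('a)" for u v :: "'a poly"
    by (intro freshmans_dream_choose) auto
  show ?case
    by (simp add: power_mult mult.commute[of "CARD('a)"] Suc.IH *)
qed simp

lemma finite_field_power_card_power:
  fixes x :: "'a::{finite,field}"
  shows "x ^ (CARD('a) ^ m) = x"
  by (induction m) (simp_all add: power_mult finite_field_power_card)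

lemma ev_frobenius:
  fixes h :: "'a::{finite,field} poly"
  shows "ev h x ^ (CARD('a) ^ m) = ev h (x ^ (CARD('a) ^ m))"
  by (induction h)
     (simp_all add: power_card_add_ac power_mult_distrib zero_power finite_field_power_card_power
       flip: to_ac_power)

text \<open>The coefficients are fixed by the power, which therefore acts on the variable alone. The
  right-hand side is linear in \<open>h\<close>; this turns the vanishing of an \<open>r\<close>-th
  power into linear equations for coefficients in Stepanov's method.\<close>

lemma poly_frobenius:
  fixes h :: "'a::{finite,field} poly"
  shows "h ^ (CARD('a) ^ m) = pcompose h (monom 1 (CARD('a) ^ m))"
proof (induction h)
  case (pCons a h)
  have "pCons a h = [:a:] + [:0, 1:] * h" by simp
  then have "pCons a h ^ (CARD('a) ^ m) = [:a:] ^ (CARD('a) ^ m) + ([:0, 1:] * h) ^ (CARD('a) ^ m)"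
    by (metis power_card_add_poly)
  also have "[:a:] ^ (CARD('a) ^ m) = [:a:]"
    by (simp add: poly_const_pow finite_field_power_card_power)
  also have "([:0, 1:] * h) ^ (CARD('a) ^ m) = monom 1 (CARD('a) ^ m) * pcompose h (monom 1 (CARD('a) ^ m))"
    unfolding power_mult_distrib pCons.IH by (simp add: monom_altdef)
  finally show ?case by (simp add: pcompose_pCons)
qed (simp add: zero_power)

section \<open>Polynomials of bounded degree\<close>

text \<open>Bounding coefficients instead of demanding \<open>degree h < n\<close> makes this a
  vector space for every \<open>n\<close>. At \<open>n = 0\<close> it is \<open>{0}\<close>, so a
  truncated bound 0 later means that a remainder vanishes.\<close>

definition polys_below :: "nat \<Rightarrow> 'a::zero poly set" where
  "polys_below n = {h. \<forall>i\<ge>n. coeff h i = 0}"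

lemma polys_below_0 [simp]: "polys_below 0 = {0}"
  by (auto simp: polys_below_def poly_eq_iff)

lemma polys_below_Suc: "polys_below (Suc n) = (\<lambda>(a, h). pCons a h) ` (UNIV \<times> polys_below n)"
proof (intro equalityI subsetI)
  fix h :: "'a poly" assume h: "h \<in> polys_below (Suc n)"
  obtain a h' where [simp]: "h = pCons a h'" by (cases h)
  have "coeff h' i = 0" if "i \<ge> n" for i
    using h that by (auto simp: polys_below_def dest: spec[of _ "Suc i"])
  then show "h \<in> (\<lambda>(a, h). pCons a h) ` (UNIV \<times> polys_below n)"
    by (auto simp: polys_below_def)
qed (auto simp: polys_below_def coeff_pCons split: nat.splits)

lemma finite_polys_below [simp]: "finite (polys_below n :: 'a::{finite,zero} poly set)"
  by (induction n) (simp_all add: polys_below_Suc)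

lemma card_polys_below: "card (polys_below n :: 'a::{finite,zero} poly set) = CARD('a) ^ n"
proof (induction n)
  case (Suc n)
  have "inj_on (\<lambda>(a, h). pCons a h) (UNIV \<times> (polys_below n :: 'a poly set))"
    by (auto simp: inj_on_def)
  then show ?case
    by (simp add: polys_below_Suc card_image card_cartesian_product Suc)
qed simp

lemma polys_below_eq_degree: "n > 0 \<Longrightarrow> polys_below n = {h. degree h < n}"
  by (auto simp: polys_below_def coeff_eq_0)
     (metis leading_coeff_0_iff degree_0 not_le)

lemma zero_in_polys_below [simp]: "0 \<in> polys_below n"
  by (simp add: polys_below_def)

lemma polys_below_add: "g \<in> polys_below n \<Longrightarrow> h \<in> polys_below n \<Longrightarrow> g + h \<in> polys_below n"
  by (simp add: polys_below_def)

lemma polys_below_diff: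
  fixes g h :: "'a::ab_group_add poly"
  shows "g \<in> polys_below n \<Longrightarrow> h \<in> polys_below n \<Longrightarrow> g - h \<in> polys_below n"
  by (simp add: polys_below_def)

lemma monic_of_degree_eq:
  "monic_of_degree n = (\<lambda>h. monom 1 n + h) ` (polys_below n :: 'a::{finite,field_gcd} poly set)"
proof (intro equalityI subsetI)
  fix f :: "'a poly" assume f: "f \<in> monic_of_degree n"
  then have "f - monom 1 n \<in> polys_below n"
    by (auto simp: monic_of_degree_def polys_below_def coeff_eq_0)
  then show "f \<in> (\<lambda>h. monom 1 n + h) ` polys_below n"
    by (metis add_diff_cancel_left' diff_add_cancel add.commute image_eqI)
next
  fix f :: "'a poly" assume "f \<in> (\<lambda>h. monom 1 n + h) ` polys_below n"
  then obtain h where h: "f = monom 1 n + h" "\<forall>i\<ge>n. coeff h i = 0"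
    by (auto simp: polys_below_def)
  have "degree f \<le> n" by (rule degree_le) (auto simp: h)
  moreover have "coeff f n = 1" by (simp add: h)
  ultimately have "degree f = n" using le_degree[of f n] by simp
  with \<open>coeff f n = 1\<close> show "f \<in> monic_of_degree n"
    by (simp add: monic_of_degree_def)
qed

lemma finite_monic_of_degree [simp]: "finite (monic_of_degree n)"
  by (simp add: monic_of_degree_eq)

lemma card_monic_of_degree:
  "card (monic_of_degree n :: 'a::{finite,field_gcd} poly set) = CARD('a) ^ n"
  by (simp add: monic_of_degree_eq card_image card_polys_below)

lemma monic_of_degree_0 [simp]: "monic_of_degree 0 = {1 :: 'a::{finite,field_gcd} poly}"
  by (simp add: monic_of_degree_eq)

section \<open>Residue fields, Euler criterion and quadratic reciprocity\<close>

lemma of_nat_card_eq_0: "of_nat CARD('a::{finite,field}) = (0::'a)"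
proof -
  have "(\<Sum>x\<in>UNIV. x + 1) = (\<Sum>x\<in>UNIV. x :: 'a)"
    by (rule sum.reindex_bij_witness[of _ "\<lambda>x. x - 1" "\<lambda>x. x + 1"]) auto
  then show ?thesis by (simp add: sum.distrib)
qed

lemma one_less_card: "CARD('a::{finite,zero_neq_one}) > 1"
proof -
  have "card {0, 1::'a} \<le> CARD('a)" by (rule card_mono) auto
  then show ?thesis by simp
qed

lemma card_ge_3:
  assumes "odd CARD('a::{finite,zero_neq_one})"
  shows "CARD('a) \<ge> 3"
  using assms one_less_card[where 'a = 'a] by (cases "CARD('a) = 2") auto

lemma irreducible_degree_pos:
  fixes P :: "'a::field poly"
  assumes "irreducible P"
  shows "degree P > 0"
proof (rule ccontr)
  assume "\<not> degree P > 0"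
  moreover have "P \<noteq> 0" using assms by (auto simp: irreducible_def)
  ultimately have "is_unit P" by (simp add: is_unit_iff_degree)
  then show False using assms by (simp add: irreducible_not_unit)
qed

lemma monic_degree_0_eq_1:
  fixes f :: "'a::comm_semiring_1 poly"
  assumes "lead_coeff f = 1" "degree f = 0"
  shows "f = 1"
  using assms by (metis coeff_pCons_0 degree_eq_zeroE one_pCons)

lemma unit_factor_eq_1_iff:
  fixes p :: "'a::field_gcd poly"
  shows "unit_factor p = 1 \<longleftrightarrow> lead_coeff p = 1"
  by (cases "p = 0") (simp_all add: unit_factor_poly_def is_unit_unit_factor dvd_field_iff one_pCons)

lemma normalize_monic:
  fixes p :: "'a::field_gcd poly"
  shows "lead_coeff p = 1 \<Longrightarrow> normalize p = p"
  by (simp add: normalize_poly_eq_map_poly)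

lemma lead_coeff_prime:
  fixes p :: "'a::field_gcd poly"
  shows "prime p \<Longrightarrow> lead_coeff p = 1"
  by (simp add: unit_factor_prime flip: unit_factor_eq_1_iff)

lemma two_neq_0:
  assumes "odd CARD('a::{finite,field})"
  shows "(2::'a) \<noteq> 0"
proof
  assume two: "(2::'a) = 0"
  obtain k where k: "CARD('a) = 2 * k + 1" using assms by (auto elim: oddE)
  have "of_nat CARD('a) = (1::'a)" unfolding k by (simp add: two)
  then show False by (simp add: of_nat_card_eq_0)
qed

lemma two_neq_0_ac:
  assumes "odd CARD('a::{finite,field})"
  shows "(2::'a alg_closure) \<noteq> 0"
  using two_neq_0[OF assms] by (metis to_ac_eq_0_iff to_ac_numeral)

text \<open>Symbols are computed as elements of the closure; this brings an equation between them
  back to the integers. Oddness of \<open>q\<close> separates 1 from -1.\<close>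

lemma of_int_sign_eq_ac:
  assumes "odd CARD('a::{finite,field})" "s \<in> {-1,0,1}" "t \<in> {-1,0,1}"
    and "(of_int s :: 'a alg_closure) = of_int t"
  shows "s = t"
proof -
  have "(1::'a alg_closure) \<noteq> -1"
    using two_neq_0_ac[OF assms(1)] by (metis add.right_inverse one_add_one)
  then show ?thesis using assms(2-4) by auto
qed

lemma qr_symbol_values: "qr_symbol a Q \<in> {-1, 0, 1}"
  by (simp add: qr_symbol_def)

text \<open>Evaluation at \<alpha> identifies the residue field of \<open>P\<close> with the subset
  \<open>K\<close> of the closure, so a congruence modulo \<open>P\<close> becomes an equation
  there.\<close>

locale prime_root =
  fixes P :: "'a::{finite,field_gcd} poly" and \<alpha> :: "'a alg_closure"
  assumes irr: "irreducible P" and monic: "lead_coeff P = 1"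
    and root: "ev P \<alpha> = 0"
begin

abbreviation "n \<equiv> degree P"
abbreviation "Q \<equiv> CARD('a) ^ n"

lemma P_nz: "P \<noteq> 0" using monic by auto

lemma n_pos: "n > 0"
  by (rule irreducible_degree_pos[OF irr])

lemmas card_gt_1 = one_less_card[where 'a = 'a]

lemma Q_gt_1: "Q > 1"
  by (rule one_less_power[OF card_gt_1 n_pos])

lemma dvd_iff_ev: "P dvd h \<longleftrightarrow> ev h \<alpha> = 0"
proof
  assume "P dvd h"
  then show "ev h \<alpha> = 0" using root by (auto elim!: dvdE)
next
  assume h: "ev h \<alpha> = 0"
  show "P dvd h"
  proof (rule ccontr)
    assume "\<not> P dvd h"
    then have "coprime P h"
      using irr by (intro prime_elem_imp_coprime irreducible_imp_prime_elem)
    then obtain u v where "u * P + v * h = 1"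
      by (metis bezout_coefficients_fst_snd coprime_iff_gcd_eq_1)
    then have "ev (u * P + v * h) \<alpha> = 1" by simp
    then show False using h root by simp
  qed
qed

definition K where "K = (\<lambda>h. ev h \<alpha>) ` polys_below n"

lemma ev_mod: "ev (h mod P) \<alpha> = ev h \<alpha>"
proof -
  have "ev h \<alpha> = ev (h div P * P + h mod P) \<alpha>" by (simp only: div_mult_mod_eq)
  also have "\<dots> = ev (h mod P) \<alpha>" by (simp only: ev_add ev_mult root mult_zero_right add_0_left)
  finally show ?thesis by simp
qed

lemma mod_in_polys_below: "h mod P \<in> polys_below n"
  using n_pos P_nz by (auto simp: polys_below_eq_degree degree_mod_less')
    (metis degree_0 degree_mod_less')

lemma ev_in_K [simp]: "ev h \<alpha> \<in> K"
  unfolding K_def by (subst ev_mod[symmetric]) (intro imageI mod_in_polys_below)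

lemma K_cases: 
  assumes "x \<in> K" obtains h where "x = ev h \<alpha>" "h \<in> polys_below n"
  using assms by (auto simp: K_def)

lemma not_dvd_polys_below:
  assumes "h \<in> polys_below n" "P dvd h" shows "h = 0"
proof (rule ccontr)
  assume "h \<noteq> 0"
  then have "degree P \<le> degree h" using assms(2) by (simp add: dvd_imp_degree_le)
  then show False using assms(1) n_pos by (simp add: polys_below_eq_degree)
qed

lemma inj_on_ev: "inj_on (\<lambda>h. ev h \<alpha>) (polys_below n)"
proof (rule inj_onI)
  fix g h assume gh: "g \<in> polys_below n" "h \<in> polys_below n" "ev g \<alpha> = ev h \<alpha>"
  then have "P dvd g - h" by (simp add: dvd_iff_ev)
  then show "g = h" using not_dvd_polys_below[of "g - h"] polys_below_diff gh by auto
qed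

lemma card_K: "card K = Q"
  unfolding K_def by (simp add: card_image inj_on_ev card_polys_below)

lemma finite_K [simp]: "finite K"
  by (simp add: K_def)

lemma K_mult: "x \<in> K \<Longrightarrow> y \<in> K \<Longrightarrow> x * y \<in> K"
  by (elim K_cases) (metis ev_mult ev_in_K)

lemma zero_in_K: "0 \<in> K"
  using ev_in_K[of 0] by simp

lemma K_power:
  assumes "x \<in> K" shows "x ^ Q = x"
proof (cases "x = 0")
  case False
  have bij: "bij_betw (\<lambda>y. x * y) (K - {0}) (K - {0})"
    unfolding bij_betw_def
  proof
    show inj: "inj_on ((*) x) (K - {0})" using False by (auto simp: inj_on_def)
    show "(*) x ` (K - {0}) = K - {0}"
      by (rule endo_inj_surj[OF _ _ inj]) (use False assms K_mult in auto)
  qed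
  have "x * (\<Prod>y\<in>K-{0}. x * y) = x * x ^ (card K - 1) * \<Prod>(K-{0})"
    by (simp add: prod.distrib mult_ac zero_in_K)
  also have "x * x ^ (card K - 1) = x ^ Q"
    using Q_gt_1 by (simp add: card_K flip: power_Suc)
  also have "(\<Prod>y\<in>K-{0}. x * y) = (\<Prod>y\<in>K-{0}. y)"
    by (rule prod.reindex_bij_betw[OF bij])
  finally show ?thesis by simp
qed (use Q_gt_1 in simp)

lemma card_power_fixed_le:
  assumes "m > 1"
  shows "card {x::'a alg_closure. x ^ m = x} \<le> m" "finite {x::'a alg_closure. x ^ m = x}"
proof -
  define p :: "'a alg_closure poly" where "p = monom 1 m - monom 1 1"
  have p: "p \<noteq> 0" using assms by (auto simp: p_def poly_eq_iff dest: spec[of _ m])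
  have "degree p \<le> m" by (rule degree_le) (use assms in \<open>auto simp: p_def\<close>)
  moreover have "{x. x ^ m = x} = {x. poly p x = 0}" by (auto simp: p_def poly_monom)
  ultimately show "card {x::'a alg_closure. x ^ m = x} \<le> m" "finite {x::'a alg_closure. x ^ m = x}"
    using card_poly_roots_bound[OF p] poly_roots_finite[OF p] by auto
qed

text \<open>\<open>K\<close> supplies \<open>Q\<close> roots of a polynomial of degree
  \<open>Q\<close>, hence all of them. An element of the closure can now be recognised as the value
  of a polynomial by a power identity.\<close>

lemma K_eq: "K = {x. x ^ Q = x}"
proof (rule card_subset_eq)
  show "finite {x::'a alg_closure. x ^ Q = x}" by (rule card_power_fixed_le) (rule Q_gt_1)
  show *: "K \<subseteq> {x. x ^ Q = x}" using K_power by auto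
  show "card K = card {x::'a alg_closure. x ^ Q = x}"
    using card_mono[OF _ *] card_power_fixed_le[OF Q_gt_1] card_K by force
qed

lemma euler_criterion:
  assumes odd: "odd CARD('a)"
  shows "ev h \<alpha> ^ ((Q - 1) div 2) = of_int (qr_symbol h P)"
proof (cases "P dvd h")
  case True
  have "odd Q" "Q > 1" using odd Q_gt_1 by simp_all
  then have "(Q - 1) div 2 > 0" by presburger
  then show ?thesis using True by (simp add: qr_symbol_def dvd_iff_ev)
next
  case False
  define x where "x = ev h \<alpha>"
  have x0: "x \<noteq> 0" using False by (simp add: x_def dvd_iff_ev)
  have "odd Q" using odd by simp
  then obtain k where k: "Q = 2 * k + 1" by (rule oddE)
  have xK: "x \<in> K" by (simp add: x_def)
  have "x * x ^ (2 * k) = x" using K_power[OF xK] by (simp add: k)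
  then have "x ^ (2 * k) = 1" using x0 by simp
  then have sq: "(x ^ k)\<^sup>2 = 1" by (simp add: power_mult[symmetric] mult.commute)
  have "(\<exists>b. P dvd b ^ 2 - h) \<longleftrightarrow> x ^ k = 1"
  proof
    assume "\<exists>b. P dvd b ^ 2 - h"
    then obtain b where b: "(ev b \<alpha>)\<^sup>2 = x" by (auto simp: dvd_iff_ev x_def)
    then have "ev b \<alpha> \<noteq> 0" using x0 by auto
    moreover have "ev b \<alpha> * ev b \<alpha> ^ (2 * k) = ev b \<alpha>"
      using K_power[of "ev b \<alpha>"] by (simp add: k)
    ultimately show "x ^ k = 1" by (simp flip: b power_mult)
  next
    assume xk: "x ^ k = 1"
    \<comment> \<open>The root is taken in the closure. The assumption \<open>x ^ k = 1\<close>
      makes it a fixed point of the \<open>Q\<close>-th power, so it lies in \<open>K\<close> and is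
      the value of a polynomial \<open>b\<close>.\<close>
    obtain y where y: "y ^ 2 = x" using nth_root_exists[of 2 x] by auto
    have "y ^ Q = (y\<^sup>2) ^ k * y" by (simp add: k power_mult)
    also have "\<dots> = y" by (simp add: y xk)
    finally have "y \<in> K" by (simp add: K_eq)
    then obtain b where "y = ev b \<alpha>" by (auto elim: K_cases)
    then show "\<exists>b. P dvd b ^ 2 - h" using y by (auto simp: dvd_iff_ev x_def)
  qed
  moreover have "x ^ k = 1 \<or> x ^ k = -1" using sq by (simp add: power2_eq_1_iff)
  ultimately show ?thesis using False k by (auto simp: qr_symbol_def x_def)
qed

lemma qr_symbol_mult:
  assumes odd: "odd CARD('a)"
  shows "qr_symbol (g * h) P = qr_symbol g P * qr_symbol h P"
proof (rule of_int_sign_eq_ac[where 'a='a])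
  show "of_int (qr_symbol (g * h) P) = (of_int (qr_symbol g P * qr_symbol h P) :: 'a alg_closure)"
    using euler_criterion[OF odd, symmetric] by (simp add: power_mult_distrib)
qed (use odd qr_symbol_values[of g P] qr_symbol_values[of h P] in \<open>auto simp: qr_symbol_def\<close>)

lemma qr_symbol_cong:
  assumes "P dvd g - h"
  shows "qr_symbol g P = qr_symbol h P"
proof -
  have "ev g \<alpha> = ev h \<alpha>" using assms by (simp add: dvd_iff_ev)
  then show ?thesis by (simp add: qr_symbol_def dvd_iff_ev)
qed

text \<open>If two conjugates coincided, \<alpha> would be fixed by the \<open>q^d\<close>-th power
  for some \<open>0 < d < n\<close>, and with it every element of \<open>K\<close>. But that power
  has at most \<open>q^d\<close> fixed points.\<close>

lemma inj_on_frobenius_conjugates: "inj_on (\<lambda>i. \<alpha> ^ (CARD('a) ^ i)) {..<n}"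
proof -
  let ?q = "CARD('a)"
  have "\<alpha> ^ (?q ^ i) \<noteq> \<alpha> ^ (?q ^ j)" if ij: "i < j" "j < n" for i j
  proof
    assume eq: "\<alpha> ^ (?q ^ i) = \<alpha> ^ (?q ^ j)"
    define d where "d = j - i"
    have d: "0 < d" "d < n" using ij by (auto simp: d_def)
    have "(\<alpha> ^ (?q ^ d) - \<alpha>) ^ (?q ^ i) + \<alpha> ^ (?q ^ i) = (\<alpha> ^ (?q ^ d)) ^ (?q ^ i)"
      by (simp flip: power_card_add_ac)
    also have "\<dots> = \<alpha> ^ (?q ^ j)"
      using ij by (simp add: d_def flip: power_mult power_add)
    finally have "\<alpha> ^ (?q ^ d) = \<alpha>" using eq by simp
    then have "K \<subseteq> {x. x ^ (?q ^ d) = x}"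
      by (auto elim!: K_cases simp: ev_frobenius)
    moreover have "?q ^ d > 1" by (rule one_less_power[OF card_gt_1 d(1)])
    ultimately have "card K \<le> ?q ^ d"
      using card_power_fixed_le[of "?q ^ d"] by (meson card_mono le_trans)
    then show False using card_gt_1 d by (simp add: card_K)
  qed
  then show ?thesis
    by (auto simp: inj_on_def) (metis linorder_neqE_nat)
qed

lemma ev_conjugate: "ev P (\<alpha> ^ (CARD('a) ^ i)) = 0"
  using root by (simp add: zero_power flip: ev_frobenius)

lemma splits: "map_poly to_ac P = (\<Prod>i<n. [:- (\<alpha> ^ (CARD('a) ^ i)), 1:])"
proof -
  let ?c = "\<lambda>i. \<alpha> ^ (CARD('a) ^ i)"
  let ?f = "map_poly to_ac P"
  have deg: "degree ?f = n" by (rule degree_map_poly) (use P_nz in auto)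
  have lc: "lead_coeff ?f = 1" using monic deg by (simp add: coeff_map_poly)
  have dv: "(\<Prod>i<m. [:- ?c i, 1:]) dvd ?f" if "m \<le> n" for m
    using that
  proof (induction m)
    case (Suc m)
    then obtain g where g: "?f = (\<Prod>i<m. [:- ?c i, 1:]) * g" by (auto elim: dvdE)
    have "poly ?f (?c m) = 0" using ev_conjugate by (simp add: ev_def)
    moreover have "poly (\<Prod>i<m. [:- ?c i, 1:]) (?c m) \<noteq> 0"
    proof -
      have "?c m \<noteq> ?c i" if "i < m" for i
        using inj_onD[OF inj_on_frobenius_conjugates, of m i] Suc.prems that by auto
      then show ?thesis by (simp add: poly_prod)
    qed
    ultimately have "poly g (?c m) = 0" by (simp add: g)
    then obtain g' where "g = [:- ?c m, 1:] * g'" by (auto simp: poly_eq_0_iff_dvd elim: dvdE)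
    then have "?f = (\<Prod>i<Suc m. [:- ?c i, 1:]) * g'" by (simp only: g prod.lessThan_Suc mult.assoc)
    then show ?case by (rule dvdI)
  qed simp
  then obtain g where g: "?f = (\<Prod>i<n. [:- ?c i, 1:]) * g" by (auto elim: dvdE)
  have monic': "lead_coeff (\<Prod>i<n. [:- ?c i, 1:]) = 1" by (simp add: lead_coeff_prod)
  have deg': "degree (\<Prod>i<n. [:- ?c i, 1:]) = n" by (subst degree_prod_eq_sum_degree) auto
  have "g \<noteq> 0" using g P_nz deg n_pos by auto
  then have "degree g = 0"
    using deg deg' g by (metis (no_types, lifting) add_cancel_left_right degree_mult_eq monic' leading_coeff_0_iff zero_neq_one)
  moreover have "lead_coeff g = 1" using lc monic' unfolding g lead_coeff_mult by simp
  ultimately have "g = 1" by (intro monic_degree_0_eq_1)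
  then show ?thesis using g by simp
qed

text \<open>Euler's exponent \<open>(Q - 1) / 2\<close> is \<open>1 + q + ... + q^(n-1)\<close>
  times \<open>(q - 1) / 2\<close>, and the first factor as an exponent yields the norm. This norm
  is the resultant of \<open>P\<close> and \<open>h\<close>, which is symmetric up to sign.\<close>

lemma euler_criterion_norm:
  assumes odd: "odd CARD('a)"
  shows "(\<Prod>i<n. ev h (\<alpha> ^ (CARD('a) ^ i))) ^ ((CARD('a) - 1) div 2) = of_int (qr_symbol h P)"
proof -
  let ?q = "CARD('a)"
  have "(\<Prod>i<n. ev h (\<alpha> ^ (?q ^ i))) = ev h \<alpha> ^ (\<Sum>i<n. ?q ^ i)"
    by (simp add: power_sum flip: ev_frobenius)
  moreover have "(\<Sum>i<n. ?q ^ i) * ((?q - 1) div 2) = (Q - 1) div 2"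
  proof -
    obtain k where k: "?q = 2 * k + 1" using odd by (auto elim: oddE)
    have "Suc ((\<Sum>i<m. ?q ^ i) * (2 * k)) = ?q ^ m" for m
      by (induction m) (simp_all add: algebra_simps k)
    from this[of n] have "Q - 1 = 2 * ((\<Sum>i<n. ?q ^ i) * k)" by simp
    then show ?thesis by (simp add: k)
  qed
  ultimately show ?thesis using euler_criterion[OF odd] by (simp flip: power_mult)
qed

end

lemma ex_prime_root:
  fixes P :: "'a::{finite,field_gcd} poly"
  assumes "irreducible P" "lead_coeff P = 1"
  obtains \<alpha> where "prime_root P \<alpha>"
proof -
  have "degree (map_poly to_ac P) > 0"
  proof -
    have "degree P > 0" by (rule irreducible_degree_pos[OF assms(1)])
    moreover have "degree (map_poly to_ac P) = degree P" by (rule degree_map_poly) auto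
    ultimately show ?thesis by simp
  qed
  then obtain \<alpha> where "ev P \<alpha> = 0" unfolding ev_def using alg_closed_imp_poly_has_root by blast
  then show ?thesis using assms that by (simp add: prime_root_def)
qed

text \<open>Both symbols are the power \<open>(q - 1) / 2\<close> of the product of all root
  differences, taken in the two orders. These differ by a sign, and the exponent is even because
  \<open>q\<close> is 1 modulo 4.\<close>

lemma quadratic_reciprocity:
  fixes P Q :: "'a::{finite,field_gcd} poly"
  assumes q: "CARD('a) mod 4 = 1"
    and P: "irreducible P" "lead_coeff P = 1"
    and Q: "irreducible Q" "lead_coeff Q = 1"
  shows "qr_symbol P Q = qr_symbol Q P"
proof -
  obtain \<alpha> where "prime_root P \<alpha>" using P by (rule ex_prime_root)
  then interpret P: prime_root P \<alpha> .
  obtain \<beta> where "prime_root Q \<beta>" using Q by (rule ex_prime_root)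
  then interpret Q: prime_root Q \<beta> .
  let ?q = "CARD('a)" and ?m = "degree P" and ?n = "degree Q"
  let ?a = "\<lambda>i. \<alpha> ^ (?q ^ i)" and ?b = "\<lambda>j. \<beta> ^ (?q ^ j)"
  have odd: "odd ?q" using q by presburger
  obtain k where "?q = 4 * k + 1" using q by (metis div_mult_mod_eq mult.commute)
  then have even: "even ((?q - 1) div 2)" by simp
  have "(\<Prod>j<?n. ev P (?b j)) = (\<Prod>j<?n. \<Prod>i<?m. ?b j - ?a i)"
    by (simp add: ev_def P.splits poly_prod)
  also have "\<dots> = (\<Prod>j<?n. \<Prod>i<?m. (-1) * (?a i - ?b j))"
    by simp
  also have "\<dots> = (\<Prod>i<?m. \<Prod>j<?n. (-1) * (?a i - ?b j))"
    by (rule prod.swap)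
  also have "\<dots> = (\<Prod>i<?m. \<Prod>j<?n. - 1) * (\<Prod>i<?m. \<Prod>j<?n. ?a i - ?b j)"
    by (simp only: prod.distrib)
  also have "(\<Prod>i<?m. \<Prod>j<?n. ?a i - ?b j) = (\<Prod>i<?m. ev Q (?a i))"
    by (simp add: ev_def Q.splits poly_prod)
  finally have eq: "(\<Prod>j<?n. ev P (?b j)) = (-1) ^ (?n * ?m) * (\<Prod>i<?m. ev Q (?a i))"
    by (simp add: power_mult)
  have "of_int (qr_symbol P Q) = (of_int (qr_symbol Q P) :: 'a alg_closure)"
    using even
    by (simp add: eq power_mult_distrib power_mult[symmetric]
        flip: P.euler_criterion_norm[OF odd] Q.euler_criterion_norm[OF odd])
  then show ?thesis
    by (rule of_int_sign_eq_ac[OF odd qr_symbol_values qr_symbol_values])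
qed

text \<open>Reciprocity is applied to each prime factor of \<open>f\<close>. Since \<open>f\<close>
  moves from the modulus to the numerator, the coefficients of the L-series become character sums
  modulo a fixed \<open>P\<close>.\<close>

lemma chi_eq_qr_symbol:
  fixes P f :: "'a::{finite,field_gcd} poly"
  assumes q: "CARD('a) mod 4 = 1"
    and P: "irreducible P" "lead_coeff P = 1" and f: "lead_coeff f = 1"
  shows "chi P f = qr_symbol f P"
proof -
  obtain \<alpha> where "prime_root P \<alpha>" using P by (rule ex_prime_root)
  then interpret P: prime_root P \<alpha> .
  have odd: "odd CARD('a)" using q by presburger
  have one: "qr_symbol 1 P = 1"
    using P.n_pos by (auto simp: qr_symbol_def is_unit_iff_degree P.P_nz intro!: exI[of _ 1])
  have "prod_mset (image_mset (qr_symbol P) M) = qr_symbol (prod_mset M) P"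
    if "\<forall>p\<in>#M. irreducible p \<and> lead_coeff p = 1" for M
    using that
  proof (induction M)
    case (add p M)
    then show ?case
      using quadratic_reciprocity[OF q P, of p] P.qr_symbol_mult[OF odd] by simp
  qed (simp add: one)
  moreover have "irreducible p \<and> lead_coeff p = 1" if "p \<in># prime_factorization f" for p
  proof -
    have "prime p" using that by (rule in_prime_factors_imp_prime)
    then show ?thesis by (simp add: lead_coeff_prime prime_elem_imp_irreducible)
  qed
  ultimately have "chi P f = qr_symbol (prod_mset (prime_factorization f)) P"
    by (simp add: chi_def jacobi_symbol_def)
  also have "prod_mset (prime_factorization f) = f"
    using f by (subst prod_mset_prime_factorization) (auto simp: normalize_monic)
  finally show ?thesis .
qed

section \<open>The functional equation\<close>

context prime_root
begin

abbreviation leg :: "'a poly \<Rightarrow> int" where "leg f \<equiv> qr_symbol f P"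

lemma leg_0 [simp]: "leg 0 = 0"
  by (simp add: qr_symbol_def)

lemma leg_1 [simp]: "leg 1 = 1"
  using n_pos by (auto simp: qr_symbol_def is_unit_iff_degree P_nz intro!: exI[of _ 1])

lemma leg_mod: "leg (h mod P) = leg h"
proof (rule qr_symbol_cong)
  have "h - h mod P = h div P * P" by (rule minus_mod_eq_div_mult)
  then have "P dvd h - h mod P" by simp
  then show "P dvd h mod P - h" by (simp add: dvd_diff_commute)
qed

lemma leg_square_eq_1: "\<not> P dvd h \<Longrightarrow> leg h * leg h = 1"
  by (simp add: qr_symbol_def)

end

locale odd_prime_root = prime_root +
  assumes odd_card: "odd CARD('a)" and odd_degree: "odd (degree P)"
begin

lemmas leg_mult = qr_symbol_mult[OF odd_card]

definition \<phi> :: "'a \<Rightarrow> int" where "\<phi> c = leg [:c:]"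

lemma \<phi>_0 [simp]: "\<phi> 0 = 0"
  by (simp add: \<phi>_def)

lemma const_dvd_iff: "P dvd [:c:] \<longleftrightarrow> c = 0"
  by (simp add: dvd_iff_ev)

lemma \<phi>_square: "c \<noteq> 0 \<Longrightarrow> \<phi> c * \<phi> c = 1"
  by (simp add: \<phi>_def leg_square_eq_1 const_dvd_iff)

lemma leg_smult: "leg (smult c f) = \<phi> c * leg f"
  using leg_mult[of "[:c:]" f] by (simp add: \<phi>_def)

text \<open>On a constant \<open>c\<close> the norm criterion gives \<open>c ^ (n * k)\<close> with
  \<open>k = (q - 1) / 2\<close>. For odd \<open>n\<close> this equals \<open>c ^ k\<close>, which
  cannot be 1 at all \<open>2 * k\<close> nonzero constants.\<close>

lemma ex_const_nonresidue: "\<exists>c. \<phi> c = -1"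
proof (rule ccontr)
  assume none: "\<nexists>c. \<phi> c = -1"
  obtain k where k: "CARD('a) = 2 * k + 1" using odd_card by (rule oddE)
  have k0: "k > 0" using k card_gt_1 by simp
  obtain l where l: "n = 2 * l + 1" using odd_degree by (rule oddE)
  have "c ^ k = 1" if "c \<noteq> 0" for c :: 'a
  proof -
    have "\<phi> c = 1"
      using none \<phi>_square[OF that] by (auto simp: zmult_eq_1_iff)
    then have "(to_ac c ^ n) ^ k = 1"
      using euler_criterion_norm[OF odd_card, of "[:c:]"] by (simp add: \<phi>_def k)
    then have "to_ac ((c ^ n) ^ k) = to_ac 1" by simp
    then have *: "(c ^ n) ^ k = 1" unfolding to_ac_eq_iff .
    have "c * c ^ (2 * k) = c" using finite_field_power_card[of c] by (simp add: k)
    then have "c ^ (2 * k) = 1" using that by simp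
    moreover have "(c ^ n) ^ k = (c ^ (2 * k)) ^ l * c ^ k"
      by (simp add: l power_add algebra_simps flip: power_mult)
    ultimately show ?thesis using * by simp
  qed
  then have sub: "UNIV - {0} \<subseteq> {c::'a. poly (monom 1 k - 1) c = 0}"
    by (auto simp: poly_monom)
  have nz: "monom 1 k - 1 \<noteq> (0 :: 'a poly)" using k0 by (auto simp: poly_eq_iff dest: spec[of _ k])
  have "degree (monom 1 k - 1 :: 'a poly) \<le> k"
    by (rule degree_le) (use k0 in auto)
  then have "card (UNIV - {0::'a}) \<le> k"
    using card_mono[OF poly_roots_finite[OF nz] sub] card_poly_roots_bound[OF nz] by linarith
  then show False using k k0 by (simp add: card_Diff_subset)
qed

lemma sum_\<phi>: "(\<Sum>c\<in>UNIV. \<phi> (a + c)) = 0"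
proof -
  obtain d where d: "\<phi> d = -1" using ex_const_nonresidue by blast
  then have d0: "d \<noteq> 0" by auto
  have "(\<Sum>c\<in>UNIV. \<phi> c) = (\<Sum>c\<in>UNIV. \<phi> (d * c))"
    by (rule sum.reindex_bij_witness[of _ "\<lambda>c. d * c" "\<lambda>c. c / d"]) (use d0 in auto)
  also have "\<dots> = (\<Sum>c\<in>UNIV. - \<phi> c)"
  proof (rule sum.cong)
    fix c show "\<phi> (d * c) = - \<phi> c"
      using leg_smult[of d "[:c:]"] d by (simp add: \<phi>_def)
  qed simp
  finally have "(\<Sum>c\<in>UNIV. \<phi> c) = 0" by (simp add: sum_negf)
  moreover have "(\<Sum>c\<in>UNIV. \<phi> (a + c)) = (\<Sum>c\<in>UNIV. \<phi> c)"
    by (rule sum.reindex_bij_witness[of _ "\<lambda>c. c - a" "\<lambda>c. a + c"]) auto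
  ultimately show ?thesis by simp
qed

lemma sum_leg: "(\<Sum>v\<in>polys_below n. leg v) = 0"
proof -
  obtain d where d: "\<phi> d = -1" using ex_const_nonresidue by blast
  then have d0: "d \<noteq> 0" by auto
  have "(\<Sum>v\<in>polys_below n. leg v) = (\<Sum>v\<in>polys_below n. leg (smult d v))"
    by (rule sum.reindex_bij_witness[of _ "\<lambda>c. smult d c" "\<lambda>c. smult (inverse d) c"])
       (use d0 in \<open>auto simp: polys_below_def\<close>)
  also have "\<dots> = - (\<Sum>v\<in>polys_below n. leg v)"
    by (simp add: leg_smult d sum_negf)
  finally show ?thesis by simp
qed

text \<open>
  The pairing \<open>(x, y) \<mapsto> lin (x y)\<close> on the residue field, combined with the restriction \<open>\<phi>\<close> of the
  symbol to constants in place of an additive character, plays the role of the Fourier kernel;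
  \<open>C\<close> is the corresponding (real) Gauss sum.
\<close>

definition lin :: "'a poly \<Rightarrow> 'a" where "lin v = coeff (v mod P) (n - 1)"

lemma lin_add: "lin (v + w) = lin v + lin w"
  by (simp add: lin_def poly_mod_add_left)

lemma lin_smult: "lin (smult c v) = c * lin v"
  by (simp add: lin_def mod_smult_left)

lemma lin_below: "v \<in> polys_below n \<Longrightarrow> lin v = coeff v (n - 1)"
  using n_pos by (simp add: lin_def polys_below_eq_degree mod_poly_less)

definition C :: int where "C = (\<Sum>v\<in>polys_below n. leg v * \<phi> (lin v))"

text \<open>Multiplication by \<open>x\<close> permutes the residues, and \<open>leg x\<close> is
  its own inverse. This is the separability of Gauss sums; when \<open>P\<close> divides
  \<open>x\<close>, both sides are 0.\<close>

lemma sum_leg_lin: "(\<Sum>v\<in>polys_below n. leg v * \<phi> (lin (x * v))) = leg x * C"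
proof (cases "P dvd x")
  case True
  then have "lin (x * v) = 0" for v by (simp add: lin_def)
  then show ?thesis using True by (simp add: qr_symbol_def)
next
  case False
  have inj: "inj_on (\<lambda>v. (x * v) mod P) (polys_below n)"
  proof (rule inj_onI)
    fix v w assume vw: "v \<in> polys_below n" "w \<in> polys_below n" "(x * v) mod P = (x * w) mod P"
    then have "ev (x * v) \<alpha> = ev (x * w) \<alpha>" by (metis ev_mod)
    then have "ev v \<alpha> = ev w \<alpha>" using False by (simp add: dvd_iff_ev)
    then show "v = w" using inj_on_ev vw by (auto dest: inj_onD)
  qed
  have bij: "bij_betw (\<lambda>v. (x * v) mod P) (polys_below n) (polys_below n)"
    unfolding bij_betw_def
    by (rule conjI[OF inj endo_inj_surj[OF _ _ inj]]) (auto intro: mod_in_polys_below)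
  have "leg x * C = leg x * (\<Sum>v\<in>polys_below n. leg ((x * v) mod P) * \<phi> (lin ((x * v) mod P)))"
    unfolding C_def by (subst sum.reindex_bij_betw[OF bij]) (rule refl)
  also have "\<dots> = (\<Sum>v\<in>polys_below n. (leg x * leg x) * leg v * \<phi> (lin (x * v)))"
    by (simp add: sum_distrib_left leg_mod leg_mult lin_def mult_ac)
  finally show ?thesis by (simp add: leg_square_eq_1[OF False])
qed

text \<open>The Fourier transform of the monic polynomials of degree \<open>m\<close>. For small
  \<open>v\<close> the product \<open>x * v\<close> is not reduced, and its coefficient at
  \<open>n - 1\<close> does not depend on \<open>x\<close>. For larger \<open>v\<close> the sum
  splits into lines on which \<open>lin (x * v)\<close> runs through the whole field, and \<phi>
  sums to 0 on each.\<close>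

lemma sum_\<phi>_lin:
  assumes m: "m < n" and v: "v \<in> polys_below n"
  shows "(\<Sum>x\<in>monic_of_degree m. \<phi> (lin (x * v))) =
    (if v \<in> polys_below (n - m) then int CARD('a) ^ m * \<phi> (coeff v (n - 1 - m)) else 0)"
proof (cases "v \<in> polys_below (n - m)")
  case True
  have "lin (x * v) = coeff v (n - 1 - m)" if "x \<in> monic_of_degree m" for x
  proof (cases "v = 0")
    case False
    have x: "lead_coeff x = 1" "degree x = m" using that by (auto simp: monic_of_degree_def)
    have dv: "degree v \<le> n - 1 - m" using True m by (auto simp: polys_below_eq_degree)
    have "degree (x * v) \<le> n - 1"
      using degree_mult_le[of x v] x dv m by linarith
    then have "lin (x * v) = coeff (x * v) (n - 1)"
      using n_pos by (intro lin_below) (auto simp: polys_below_eq_degree)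
    also have "\<dots> = coeff (x * v) (m + (n - 1 - m))" using m by simp
    also have "\<dots> = coeff v (n - 1 - m)"
    proof (cases "degree v = n - 1 - m")
      case True
      then show ?thesis using coeff_mult_degree_sum[of x v] x by simp
    next
      case False
      then have "degree v < n - 1 - m" using dv by simp
      then show ?thesis using degree_mult_le[of x v] x m by (simp add: coeff_eq_0)
    qed
    finally show ?thesis .
  qed (simp add: lin_def)
  then show ?thesis using True by (simp add: card_monic_of_degree)
next
  case False
  define d where "d = degree v"
  have v0: "v \<noteq> 0" using False by auto
  have d: "d < n" "d \<ge> n - m" using v False m n_pos by (auto simp: d_def polys_below_eq_degree)
  \<comment> \<open>The direction of these lines: \<open>y * v\<close> is monic of degree
    \<open>n - 1\<close>, so \<open>lin\<close> maps it to 1. The bound \<open>d \<ge> n - m\<close>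
    gives \<open>y\<close> degree below \<open>m\<close>, so adding multiples of \<open>y\<close> to
    \<open>x\<close> keeps \<open>x\<close> monic of degree \<open>m\<close>.\<close>
  define y where "y = smult (inverse (lead_coeff v)) (monom 1 (n - 1 - d))"
  have y: "y \<in> polys_below m" using d m by (auto simp: y_def polys_below_def)
  have lin_y: "lin (y * v) = 1"
  proof -
    have "y \<noteq> 0" "degree y = n - 1 - d" using v0 by (simp_all add: y_def degree_monom_eq monom_eq_0_iff)
    then have dy: "degree (y * v) = n - 1" using v0 d by (simp add: degree_mult_eq flip: d_def)
    then have "y * v \<in> polys_below n" using n_pos by (simp add: polys_below_eq_degree)
    then have "lin (y * v) = lead_coeff (y * v)" by (simp only: lin_below dy)
    also have "\<dots> = 1" using v0 by (simp only: lead_coeff_mult) (simp add: y_def degree_monom_eq)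
    finally show ?thesis .
  qed
  let ?S = "\<Sum>h\<in>polys_below m. \<phi> (lin ((monom 1 m + h) * v))"
  have shift: "(\<Sum>h\<in>polys_below m. \<phi> (lin ((monom 1 m + (h + smult c y)) * v))) = ?S" for c
    by (rule sum.reindex_bij_witness[of _ "\<lambda>h. h - smult c y" "\<lambda>h. h + smult c y"])
       (use y in \<open>auto simp: polys_below_def\<close>)
  have "int CARD('a) * ?S = (\<Sum>c\<in>(UNIV::'a set). ?S)" by simp
  also have "\<dots> = (\<Sum>c\<in>UNIV. \<Sum>h\<in>polys_below m. \<phi> (lin ((monom 1 m + (h + smult c y)) * v)))"
    by (simp only: shift)
  also have "\<dots> = (\<Sum>h\<in>polys_below m. \<Sum>c\<in>UNIV. \<phi> (lin ((monom 1 m + h) * v) + c))"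
    by (subst sum.swap) (simp add: ring_distribs lin_add lin_smult lin_y add.assoc)
  also have "\<dots> = 0" by (simp add: sum_\<phi>)
  finally have "?S = 0" using card_gt_1 by simp
  moreover have "(\<Sum>x\<in>monic_of_degree m. \<phi> (lin (x * v))) = ?S"
    by (simp add: monic_of_degree_eq sum.reindex)
  ultimately show ?thesis using False by simp
qed

definition coef :: "nat \<Rightarrow> int" where "coef m = (\<Sum>f\<in>monic_of_degree m. leg f)"

lemma coef_0: "coef 0 = 1"
  by (simp add: coef_def)

text \<open>Writing \<open>v\<close> as \<open>c\<close> times a monic \<open>f\<close> of degree
  \<open>k\<close> produces \<phi> of \<open>c\<close> twice, from the symbol and from the kernel,
  and these cancel. Smaller degrees drop out because \<phi> vanishes at 0.\<close>

lemma sum_leg_lead: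
  "(\<Sum>v\<in>polys_below (Suc k). leg v * \<phi> (coeff v k)) = (int CARD('a) - 1) * coef k"
proof -
  have "(\<Sum>v\<in>polys_below (Suc k). leg v * \<phi> (coeff v k)) =
      (\<Sum>v\<in>{v \<in> polys_below (Suc k). coeff v k \<noteq> 0}. leg v * \<phi> (coeff v k))"
    by (intro sum.mono_neutral_right) auto
  also have "\<dots> = (\<Sum>(c, f)\<in>(UNIV - {0::'a}) \<times> monic_of_degree k. leg f)"
  proof (rule sum.reindex_bij_witness[of _ "\<lambda>(c :: 'a, f). smult c f"
        "\<lambda>v :: 'a poly. (coeff v k, smult (inverse (coeff v k)) v)"])
    fix v :: "'a poly" assume v: "v \<in> {v \<in> polys_below (Suc k). coeff v k \<noteq> 0}"
    then have deg: "degree v = k"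
      using le_degree[of v k] by (auto simp: polys_below_eq_degree)
    show "(case (coeff v k, smult (inverse (coeff v k)) v) of (c, f) \<Rightarrow> smult c f) = v"
      using v by simp
    show "(coeff v k, smult (inverse (coeff v k)) v) \<in> (UNIV - {0}) \<times> monic_of_degree k"
      using v deg by (auto simp: monic_of_degree_def)
    have "leg v = \<phi> (coeff v k) * leg (smult (inverse (coeff v k)) v)"
      using v by (simp flip: leg_smult)
    moreover have "\<phi> (coeff v k) * \<phi> (coeff v k) = 1" using v by (simp add: \<phi>_square)
    ultimately show "(case (coeff v k, smult (inverse (coeff v k)) v) of (c, f) \<Rightarrow> leg f)
        = leg v * \<phi> (coeff v k)"
      by (metis (no_types, lifting) mult.assoc mult.commute mult_1 prod.case)
  next
    fix b :: "'a \<times> 'a poly" assume "b \<in> (UNIV - {0}) \<times> monic_of_degree k"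
    then obtain c f where b: "b = (c, f)" "c \<noteq> 0" "lead_coeff f = 1" "degree f = k"
      by (auto simp: monic_of_degree_def)
    then have ck: "coeff (smult c f) k = c" by simp
    show "(coeff (case b of (c, f) \<Rightarrow> smult c f) k,
      smult (inverse (coeff (case b of (c, f) \<Rightarrow> smult c f) k)) (case b of (c, f) \<Rightarrow> smult c f)) = b"
      using b ck by simp
    show "(case b of (c, f) \<Rightarrow> smult c f) \<in> {v \<in> polys_below (Suc k). coeff v k \<noteq> 0}"
      using b ck by (auto simp: polys_below_eq_degree)
  qed
  also have "\<dots> = (int CARD('a) - 1) * coef k"
    using card_gt_1
    by (simp add: coef_def card_Diff_subset of_nat_diff flip: sum.cartesian_product)
  finally show ?thesis .
qed

text \<open>Poisson summation: each \<open>leg x\<close> is expanded by \<open>sum_leg_lin\<close>,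
  and after swapping the sums only \<open>v\<close> of degree below \<open>n - m\<close> survive.
  Degree \<open>m\<close> is thereby exchanged for degree \<open>n - 1 - m\<close>.\<close>

lemma C_mult_coef:
  assumes "m < n"
  shows "C * coef m = int CARD('a) ^ m * (int CARD('a) - 1) * coef (n - 1 - m)"
proof -
  have "C * coef m = (\<Sum>x\<in>monic_of_degree m. leg x * C)"
    by (simp add: coef_def sum_distrib_left mult.commute)
  also have "\<dots> = (\<Sum>x\<in>monic_of_degree m. \<Sum>v\<in>polys_below n. leg v * \<phi> (lin (x * v)))"
    by (simp add: sum_leg_lin)
  also have "\<dots> = (\<Sum>v\<in>polys_below n. leg v * (\<Sum>x\<in>monic_of_degree m. \<phi> (lin (x * v))))"
    by (subst sum.swap) (simp add: sum_distrib_left)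
  also have "\<dots> = (\<Sum>v\<in>polys_below n. if v \<in> polys_below (n - m)
        then int CARD('a) ^ m * (leg v * \<phi> (coeff v (n - 1 - m))) else 0)"
    by (intro sum.cong) (auto simp: sum_\<phi>_lin[OF assms])
  also have "\<dots> = (\<Sum>v\<in>polys_below (n - m). int CARD('a) ^ m * (leg v * \<phi> (coeff v (n - 1 - m))))"
  proof (rule sum.mono_neutral_cong_right)
    show "polys_below (n - m) \<subseteq> (polys_below n :: 'a poly set)" by (auto simp: polys_below_def)
  qed auto
  also have "n - m = Suc (n - 1 - m)" using assms by simp
  also have "(\<Sum>v\<in>polys_below (Suc (n - 1 - m)). int CARD('a) ^ m * (leg v * \<phi> (coeff v (n - 1 - m))))
      = int CARD('a) ^ m * ((int CARD('a) - 1) * coef (n - 1 - m))"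
    by (simp only: sum_leg_lead flip: sum_distrib_left)
  finally show ?thesis by (simp add: mult.assoc)
qed

text \<open>The monic polynomials of degree \<open>m\<close> are invariant under translation by
  every reduced residue, and the symbol sums to 0 over a complete residue system.\<close>

lemma coef_eq_0:
  assumes "m \<ge> n" shows "coef m = 0"
proof -
  let ?S = "\<Sum>h\<in>polys_below m. leg (monom 1 m + h)"
  have shift: "(\<Sum>h\<in>polys_below m. leg (monom 1 m + (h + z))) = ?S" if "z \<in> polys_below n" for z
    by (rule sum.reindex_bij_witness[of _ "\<lambda>h. h - z" "\<lambda>h. h + z"])
       (use that assms in \<open>auto simp: polys_below_def\<close>)
  have zero: "(\<Sum>z\<in>polys_below n. leg (w + z)) = 0" for w
  proof -
    have "(\<Sum>z\<in>polys_below n. leg (w + z)) = (\<Sum>z\<in>polys_below n. leg (w mod P + z))"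
    proof (rule sum.cong)
      fix z
      have "leg (w + z) = leg ((w + z) mod P)" by (simp add: leg_mod)
      also have "(w + z) mod P = (w mod P + z) mod P" by (simp add: mod_add_left_eq)
      also have "leg \<dots> = leg (w mod P + z)" by (rule leg_mod)
      finally show "leg (w + z) = leg (w mod P + z)" .
    qed simp
    also have "\<dots> = (\<Sum>z\<in>polys_below n. leg z)"
      by (rule sum.reindex_bij_witness[of _ "\<lambda>z. z - w mod P" "\<lambda>z. w mod P + z"])
         (auto intro: polys_below_add polys_below_diff mod_in_polys_below)
    finally show ?thesis by (simp add: sum_leg)
  qed
  have "int (card (polys_below n :: 'a poly set)) * ?S
      = (\<Sum>z\<in>(polys_below n :: 'a poly set). ?S)" by simp
  also have "\<dots> = (\<Sum>z\<in>polys_below n. \<Sum>h\<in>polys_below m. leg (monom 1 m + (h + z)))"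
    by (rule sum.cong[OF refl]) (rule shift[symmetric])
  also have "\<dots> = (\<Sum>h\<in>polys_below m. \<Sum>z\<in>polys_below n. leg ((monom 1 m + h) + z))"
    by (subst sum.swap) (simp add: add.assoc)
  also have "\<dots> = 0" by (simp add: zero)
  finally have "?S = 0" using card_gt_1 by (simp add: card_polys_below)
  then show ?thesis
    by (simp add: coef_def monic_of_degree_eq sum.reindex)
qed

text \<open>The case \<open>m = 0\<close> of \<open>C_mult_coef\<close> expresses the Gauss sum
  through \<open>coef (n - 1)\<close>, so it can be eliminated without being evaluated. What remains
  unknown is only the sign of \<open>coef (n - 1)\<close>.\<close>

lemma coef_functional_equation:
  assumes "m < n"
  shows "coef (n - 1) * coef m = int CARD('a) ^ m * coef (n - 1 - m)"
proof -
  have "C = (int CARD('a) - 1) * coef (n - 1)"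
    using C_mult_coef[of 0] n_pos by (simp add: coef_0)
  then have "(int CARD('a) - 1) * (coef (n - 1) * coef m) = (int CARD('a) - 1) * (int CARD('a) ^ m * coef (n - 1 - m))"
    using C_mult_coef[OF assms] by (simp add: mult_ac)
  then show ?thesis using card_gt_1 by simp
qed

lemma coef_top_square: "(coef (n - 1))\<^sup>2 = int CARD('a) ^ (n - 1)"
  using coef_functional_equation[of "n - 1"] n_pos by (simp add: coef_0 power2_eq_square)

end

section \<open>The squared L-value as a sum over pairs of total degree at most 2g\<close>

text \<open>Reflecting both indices, \<open>i\<close> to \<open>2 * g - i\<close> and
  \<open>j\<close> to \<open>2 * g - j\<close>, exchanges the terms with \<open>i + j\<close> below
  and above \<open>2 * g\<close>. Each term is multiplied by the square of the sign, so the sign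
  need not be known.\<close>

lemma square_sum_self_dual:
  fixes c :: "nat \<Rightarrow> real"
  assumes dual: "\<And>m. m \<le> 2 * g \<Longrightarrow> c (2 * g - m) = e * c m" and e: "e\<^sup>2 = 1"
  shows "(\<Sum>m\<le>2*g. c m)\<^sup>2 = (\<Sum>k\<le>2*g. (if k = 2*g then 1 else 2) * (\<Sum>i\<le>k. c i * c (k - i)))"
proof -
  let ?M = "2 * g"
  define A where "A R = {(i, j) \<in> {..?M} \<times> {..?M}. R (i + j) ?M}" for R :: "nat \<Rightarrow> nat \<Rightarrow> bool"
  define F where "F R = (\<Sum>(i, j)\<in>A R. c i * c j)" for R :: "nat \<Rightarrow> nat \<Rightarrow> bool"
  have fin: "finite (A R)" for R
    by (rule finite_subset[of _ "{..?M} \<times> {..?M}"]) (auto simp: A_def)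
  have "(\<Sum>m\<le>?M. c m)\<^sup>2 = (\<Sum>(i, j)\<in>{..?M} \<times> {..?M}. c i * c j)"
    by (simp add: power2_eq_square sum_product sum.cartesian_product)
  also have "{..?M} \<times> {..?M} = (A (<) \<union> A (=)) \<union> A (>)"
    by (auto simp: A_def)
  also have "(\<Sum>(i, j)\<in>(A (<) \<union> A (=)) \<union> A (>). c i * c j) = F (<) + F (=) + F (>)"
    unfolding F_def
    by (subst sum.union_disjoint, use fin in simp, use fin in simp, force simp: A_def)+ simp
  also have "F (>) = F (<)"
    unfolding F_def
  proof (rule sum.reindex_bij_witness[of _ "\<lambda>(i, j). (?M - i, ?M - j)" "\<lambda>(i, j). (?M - i, ?M - j)"])
    fix a assume "a \<in> A (>)"
    then obtain i j where a: "a = (i, j)" "i \<le> ?M" "j \<le> ?M" by (auto simp: A_def)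
    have "c (?M - i) * c (?M - j) = e\<^sup>2 * (c i * c j)"
      by (simp only: dual[OF a(2)] dual[OF a(3)]) (simp add: power2_eq_square)
    then show "(case case a of (i, j) \<Rightarrow> (?M - i, ?M - j) of (i, j) \<Rightarrow> c i * c j) = (case a of (i, j) \<Rightarrow> c i * c j)"
      by (simp add: a e)
  qed (auto simp: A_def)
  also have "F (<) + F (=) + F (<) = 2 * F (<) + F (=)" by simp
  also have "F (<) = (\<Sum>k<?M. \<Sum>i\<le>k. c i * c (k - i))"
    unfolding F_def sum.Sigma[OF finite_lessThan ballI[OF finite_atMost]]
    by (rule sum.reindex_bij_witness[of _ "\<lambda>(k, i). (i, k - i)" "\<lambda>(i, j). (i + j, i)"])
       (auto simp: A_def)
  also have "F (=) = (\<Sum>i\<le>?M. c i * c (?M - i))"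
    unfolding F_def
    by (rule sum.reindex_bij_witness[of _ "\<lambda>i. (i, ?M - i)" "\<lambda>(i, j). i"])
       (auto simp: A_def, metis add_diff_cancel_left')
  also have "2 * (\<Sum>k<?M. \<Sum>i\<le>k. c i * c (k - i)) + (\<Sum>i\<le>?M. c i * c (?M - i)) =
      (\<Sum>k<?M. (if k = ?M then 1 else 2) * (\<Sum>i\<le>k. c i * c (k - i))) + (\<Sum>i\<le>?M. c i * c (?M - i))"
    by (simp add: sum_distrib_left)
  also have "\<dots> = (\<Sum>k\<le>?M. (if k = ?M then 1 else 2) * (\<Sum>i\<le>k. c i * c (k - i)))"
    by (simp flip: lessThan_Suc_atMost)
  finally show ?thesis .
qed

definition monic_pairs :: "nat \<Rightarrow> ('a::{finite,field_gcd} poly \<times> 'a poly) set" where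
  "monic_pairs k = (\<Union>i\<le>k. monic_of_degree i \<times> monic_of_degree (k - i))"

lemma sum_monic_pairs:
  "(\<Sum>p\<in>monic_pairs k. F p) = (\<Sum>i\<le>k. \<Sum>f\<in>monic_of_degree i. \<Sum>g\<in>monic_of_degree (k - i). F (f, g))"
  unfolding monic_pairs_def
  by (subst sum.UNION_disjoint) (auto simp: monic_of_degree_def[of _] sum.cartesian_product
     finite_monic_of_degree[unfolded monic_of_degree_def])

lemma card_monic_pairs:
  "card (monic_pairs k :: ('a::{finite,field_gcd} poly \<times> 'a poly) set) = (k + 1) * CARD('a) ^ k"
proof -
  have "card (monic_pairs k :: ('a poly \<times> 'a poly) set) = (\<Sum>p\<in>(monic_pairs k :: ('a poly \<times> 'a poly) set). 1)"
    by simp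
  also have "\<dots> = (\<Sum>i\<le>k. CARD('a) ^ i * CARD('a) ^ (k - i))"
    unfolding sum_monic_pairs by (simp add: card_monic_of_degree)
  also have "\<dots> = (\<Sum>i\<le>k. CARD('a) ^ k)" by (intro sum.cong) (auto simp flip: power_add)
  finally show ?thesis by simp
qed

lemma L_half_square:
  fixes P :: "'a::{finite,field_gcd} poly"
  assumes q: "CARD('a) mod 4 = 1" and P: "P \<in> monic_irreducibles_of_degree (2 * g + 1)"
  shows "(L_half P)\<^sup>2 = (\<Sum>k\<le>2*g. (if k = 2*g then 1 else 2) / sqrt (real CARD('a)) ^ k
           * (\<Sum>(f1, f2)\<in>monic_pairs k. real_of_int (qr_symbol (f1 * f2) P)))"
proof -
  have P': "irreducible P" "lead_coeff P = 1" "degree P = 2 * g + 1"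
    using P by (auto simp: monic_irreducibles_of_degree_def)
  have odd: "odd CARD('a)" using q by presburger
  obtain \<alpha> where "prime_root P \<alpha>" using P'(1,2) by (rule ex_prime_root)
  then interpret odd_prime_root P \<alpha>
    by (auto simp: odd_prime_root_def odd_prime_root_axioms_def odd P')
  define s where "s = sqrt (real CARD('a))"
  have s: "s > 0" "s\<^sup>2 = real CARD('a)" by (simp_all add: s_def)
  define c where "c m = real_of_int (coef m) / s ^ m" for m
  have L: "L_coeff P m * real CARD('a) powr (- real m / 2) = c m" for m
  proof -
    have "L_coeff P m = real_of_int (coef m)"
      unfolding L_coeff_def coef_def of_int_sum
      by (intro sum.cong) (auto simp: chi_eq_qr_symbol[OF q P'(1,2)] monic_of_degree_def)
    moreover have "real CARD('a) powr (- real m / 2) = 1 / s ^ m"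
    proof -
      have "real CARD('a) = s powr 2" using s by simp
      then have "real CARD('a) powr (- real m / 2) = s powr (- real m)"
        by (simp only: powr_powr) simp
      then show ?thesis using s by (simp add: powr_minus powr_realpow divide_simps)
    qed
    ultimately show ?thesis by (simp add: c_def)
  qed
  have "L_half P = (\<Sum>m\<in>{..2*g}. c m)"
    unfolding L_half_def L by (rule suminf_finite) (auto simp: c_def coef_eq_0 P')
  also have "\<dots>\<^sup>2 = (\<Sum>k\<le>2*g. (if k = 2*g then 1 else 2) * (\<Sum>i\<le>k. c i * c (k - i)))"
  proof (rule square_sum_self_dual)
    \<comment> \<open>The sign of the functional equation. The division of \<open>coef m\<close> by
      \<open>q^(m/2)\<close> in \<open>c\<close> makes that equation an exact symmetry.\<close>
    let ?e = "real_of_int (coef (2 * g)) / real CARD('a) ^ g"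
    have "(real_of_int (coef (2 * g)))\<^sup>2 = real CARD('a) ^ (2 * g)"
      using arg_cong[OF coef_top_square, of real_of_int] by (simp add: P')
    then show "?e\<^sup>2 = 1" by (simp add: power_divide flip: power_mult) (simp add: mult.commute)
    fix m assume m: "m \<le> 2 * g"
    have "real_of_int (coef (2*g)) * real_of_int (coef m) = s ^ (2 * m) * real_of_int (coef (2*g - m))"
      using arg_cong[OF coef_functional_equation[of m], of real_of_int] m by (simp add: P' s power_mult)
    moreover have "s ^ (2 * m) = s ^ m * s ^ m" by (simp add: power_add mult_2)
    moreover have "real CARD('a) ^ g = s ^ m * s ^ (2 * g - m)"
      using m by (simp flip: s(2) power_mult power_add)
    ultimately show "c (2 * g - m) = ?e * c m"
      using s by (simp add: c_def field_simps)
  qed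
  also have "\<dots> = (\<Sum>k\<le>2*g. (if k = 2*g then 1 else 2) / s ^ k
           * (\<Sum>(f1, f2)\<in>monic_pairs k. real_of_int (qr_symbol (f1 * f2) P)))"
  proof (rule sum.cong)
    fix k
    have "(\<Sum>i\<le>k. c i * c (k - i)) = (\<Sum>i\<le>k. real_of_int (coef i * coef (k - i)) / s ^ k)"
      by (intro sum.cong) (auto simp: c_def simp flip: power_add)
    also have "\<dots> = (\<Sum>i\<le>k. real_of_int (coef i * coef (k - i))) / s ^ k"
      by (simp add: sum_divide_distrib)
    also have "(\<Sum>i\<le>k. real_of_int (coef i * coef (k - i))) =
        (\<Sum>(f1, f2)\<in>monic_pairs k. real_of_int (qr_symbol (f1 * f2) P))"
      by (simp add: sum_monic_pairs coef_def sum_product leg_mult)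
    finally show "(if k = 2*g then 1 else 2) * (\<Sum>i\<le>k. c i * c (k - i)) =
      (if k = 2*g then 1 else 2) / s ^ k * (\<Sum>(f1, f2)\<in>monic_pairs k. real_of_int (qr_symbol (f1 * f2) P))"
      by simp
  qed simp
  finally show ?thesis by (simp add: s_def)
qed

section \<open>Stepanov's method\<close>

lemma polys_below_mono: "m \<le> n \<Longrightarrow> h \<in> polys_below m \<Longrightarrow> h \<in> polys_below n"
  by (auto simp: polys_below_def)

lemma polys_below_sum: "(\<And>i. i \<in> I \<Longrightarrow> F i \<in> polys_below n) \<Longrightarrow> sum F I \<in> polys_below n"
  by (simp add: polys_below_def coeff_sum)

lemma polys_below_smult: "h \<in> polys_below n \<Longrightarrow> smult c h \<in> polys_below n"
  by (simp add: polys_below_def)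

lemma polys_below_uminus: "h \<in> polys_below n \<Longrightarrow> - (h :: 'a::ab_group_add poly) \<in> polys_below n"
  by (simp add: polys_below_def)

lemma polys_below_iff: "h \<in> polys_below n \<longleftrightarrow> h = 0 \<or> degree h < n"
  by (auto simp: polys_below_def coeff_eq_0 not_le[symmetric])

lemma polys_below_mult:
  assumes "g \<in> polys_below m" "h \<in> polys_below n" "m + n \<le> k + 1"
  shows "g * h \<in> polys_below k"
proof (cases "g = 0 \<or> h = 0")
  case False
  then have "degree g < m" "degree h < n" using assms by (auto simp: polys_below_iff)
  then show ?thesis using degree_mult_le[of g h] assms(3) by (auto simp: polys_below_iff)
qed auto

lemma monom_in_polys_below: "monom c i \<in> polys_below (Suc i)"
  by (auto simp: polys_below_def)

text \<open>Since \<open>A \<le> r\<close>, the blocks do not overlap and the top nonzero one can be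
  isolated. Below it lies a gap of length \<open>r - A\<close>, which later absorbs the cross terms
  of a square. For \<open>i = 0\<close> the bound on \<open>W\<close> truncates to 0, so
  \<open>W = 0\<close>.\<close>

lemma block_sum_split:
  fixes w :: "nat \<Rightarrow> 'a::comm_ring_1 poly"
  assumes w: "\<And>j. w j \<in> polys_below A" and A: "A \<le> r" and nz: "\<exists>j<J. w j \<noteq> 0"
  obtains i W where "i < J" "w i \<noteq> 0" "(\<Sum>j<J. monom 1 (j * r) * w j) = monom 1 (i * r) * w i + W"
    "W \<in> polys_below (i * r + A - r)"
proof -
  define i where "i = Max {j. j < J \<and> w j \<noteq> 0}"
  have fin: "finite {j. j < J \<and> w j \<noteq> 0}" by simp
  have i: "i < J" "w i \<noteq> 0" using Max_in[OF fin] nz by (auto simp: i_def)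
  have top: "w j = 0" if "i < j" "j < J" for j
  proof (rule ccontr)
    assume "w j \<noteq> 0"
    then have "j \<le> i" unfolding i_def using that by (intro Max_ge[OF fin]) simp
    then show False using that by simp
  qed
  have "(\<Sum>j<J. monom 1 (j * r) * w j) = (\<Sum>j<Suc i. monom 1 (j * r) * w j)"
    by (rule sum.mono_neutral_right) (use i top in \<open>auto simp: not_less_eq\<close>)
  also have "\<dots> = monom 1 (i * r) * w i + (\<Sum>j<i. monom 1 (j * r) * w j)" by simp
  finally have eq: "(\<Sum>j<J. monom 1 (j * r) * w j) = monom 1 (i * r) * w i + (\<Sum>j<i. monom 1 (j * r) * w j)" .
  have "(\<Sum>j<i. monom 1 (j * r) * w j) \<in> polys_below (i * r + A - r)"
  proof (rule polys_below_sum)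
    fix j assume "j \<in> {..<i}"
    then have "Suc j * r \<le> i * r" by (intro mult_right_mono) auto
    then show "monom 1 (j * r) * w j \<in> polys_below (i * r + A - r)"
      by (intro polys_below_mult[OF monom_in_polys_below w]) auto
  qed
  then show ?thesis using that i eq by blast
qed

lemma polys_below_pcompose_monom:
  fixes h :: "'a::idom poly"
  assumes "h \<in> polys_below (Suc A)"
  shows "pcompose h (monom 1 r) \<in> polys_below (Suc (A * r))"
proof -
  have "degree h \<le> A" using assms by (auto simp: polys_below_iff)
  then have "degree (pcompose h (monom 1 r)) \<le> A * r"
    by (simp add: degree_pcompose degree_monom_eq)
  then show ?thesis by (auto simp: polys_below_iff)
qed

text \<open>
  By counting, there is a nontrivial choice of the \<open>a j\<close> and \<open>b j\<close>: there are \<open>2 A J\<close> free coefficients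
  against fewer linear conditions. With \<open>r = q\<^sup>g\<close> and \<open>r' = q\<^bsup>g+1\<^esup>\<close>, the auxiliary polynomial is then
  \<open>R = \<Sum>j. T\<^bsup>j r'\<^esup> (a j + b j f\<^bsup>(r' - 1)/2\<^esup>)\<close>. Taking its \<open>r\<close>-th power modulo a prime of degree \<open>2g + 1\<close>
  replaces \<open>T\<^bsup>r r'\<^esup>\<close> by \<open>T\<close>, so that \<open>f\<^bsup>A\<^esup> R\<^bsup>r\<^esup>\<close> becomes the left-hand side of the last equation.
\<close>

lemma stepanov_coefficients:
  fixes f :: "'a::{finite,field_gcd} poly"
  assumes A: "A > 0" and r: "r = 2 * A + 1"
  defines "J \<equiv> A + degree f + 1"
  obtains a b where "\<And>j. a j \<in> polys_below A" "\<And>j. b j \<in> polys_below A" "\<exists>j<J. a j \<noteq> 0 \<or> b j \<noteq> 0"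
    "(\<Sum>j<J. monom 1 j * (pcompose (a j) (monom 1 r) * f ^ A + smult \<sigma> (pcompose (b j) (monom 1 r)))) = 0"
proof -
  obtain B where B: "A = Suc B" using A by (cases A) auto
  let ?X = "PiE {..<J} (\<lambda>_. polys_below A \<times> polys_below A :: ('a poly \<times> 'a poly) set)"
  let ?\<Phi> = "\<lambda>c :: nat \<Rightarrow> 'a poly \<times> 'a poly. \<Sum>j<J. monom 1 j * (pcompose (fst (c j)) (monom 1 r) * f ^ A
      + smult \<sigma> (pcompose (snd (c j)) (monom 1 r)))"
  define D where "D = J + B * r + degree f * A"
  have deg_f: "f ^ A \<in> polys_below (Suc (degree f * A))"
    using degree_power_le[of f A] by (auto simp: polys_below_iff)
  have maps: "?\<Phi> c \<in> polys_below D" if c: "c \<in> ?X" for c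
  proof (rule polys_below_sum)
    fix j assume j: "j \<in> {..<J}"
    then have c': "fst (c j) \<in> polys_below (Suc B)" "snd (c j) \<in> polys_below (Suc B)"
      using c B by (auto simp: PiE_def Pi_def mem_Times_iff)
    have "pcompose (fst (c j)) (monom 1 r) * f ^ A \<in> polys_below (Suc (B * r + degree f * A))"
      by (rule polys_below_mult[OF polys_below_pcompose_monom[OF c'(1)] deg_f]) simp
    moreover have "smult \<sigma> (pcompose (snd (c j)) (monom 1 r)) \<in> polys_below (Suc (B * r + degree f * A))"
      by (rule polys_below_mono[OF _ polys_below_smult[OF polys_below_pcompose_monom[OF c'(2)]]]) simp
    ultimately have "pcompose (fst (c j)) (monom 1 r) * f ^ A + smult \<sigma> (pcompose (snd (c j)) (monom 1 r))
        \<in> polys_below (Suc (B * r + degree f * A))" by (rule polys_below_add)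
    then show "monom 1 j * (pcompose (fst (c j)) (monom 1 r) * f ^ A + smult \<sigma> (pcompose (snd (c j)) (monom 1 r)))
        \<in> polys_below D"
      by (rule polys_below_mult[OF monom_in_polys_below]) (use j in \<open>simp add: D_def\<close>)
  qed
  have "card ?X = CARD('a) ^ (2 * A * J)"
    by (simp add: card_PiE card_cartesian_product card_polys_below flip: power_add power_mult mult_2)
  \<comment> \<open>With \<open>m = degree f\<close>, the difference \<open>2 * A * J - D\<close>
    equals \<open>m * (A - 1) + 2 * A\<close>. The \<open>m\<close> additional blocks in
    \<open>J\<close> pay for the degree of \<open>f ^ A\<close>.\<close>
  moreover have "D < 2 * A * J"
    by (simp add: D_def J_def r B algebra_simps)
  ultimately have "card (polys_below D :: 'a poly set) < card ?X"
    using one_less_card[where 'a = 'a] by (simp add: card_polys_below)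
  moreover have "card (?\<Phi> ` ?X) \<le> card (polys_below D :: 'a poly set)"
    by (intro card_mono image_subsetI maps) auto
  ultimately have "\<not> inj_on ?\<Phi> ?X" by (intro pigeonhole) linarith
  then obtain c c' where cc: "c \<in> ?X" "c' \<in> ?X" "c \<noteq> c'" "?\<Phi> c = ?\<Phi> c'"
    by (auto simp: inj_on_def)
  define a where "a j = (if j < J then fst (c j) - fst (c' j) else 0)" for j
  define b where "b j = (if j < J then snd (c j) - snd (c' j) else 0)" for j
  show ?thesis
  proof (rule that)
    show "a j \<in> polys_below A" "b j \<in> polys_below A" for j
      using cc by (auto simp: a_def b_def PiE_def Pi_def mem_Times_iff intro!: polys_below_diff)
    show "\<exists>j<J. a j \<noteq> 0 \<or> b j \<noteq> 0"
    proof (rule ccontr)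
      assume "\<not> ?thesis"
      then have "c j = c' j" if "j < J" for j
        using that by (auto simp: a_def b_def prod_eq_iff)
      then have "c = c'" using cc by (intro PiE_ext[of c _ _ c']) auto
      then show False using cc by simp
    qed
    have "(\<Sum>j<J. monom 1 j * (pcompose (a j) (monom 1 r) * f ^ A + smult \<sigma> (pcompose (b j) (monom 1 r)))) = ?\<Phi> c - ?\<Phi> c'"
      unfolding sum_subtractf[symmetric]
      by (intro sum.cong) (auto simp: a_def b_def pcompose_diff smult_diff_right algebra_simps)
    then show "(\<Sum>j<J. monom 1 j * (pcompose (a j) (monom 1 r) * f ^ A + smult \<sigma> (pcompose (b j) (monom 1 r)))) = 0"
      using cc(4) by simp
  qed
qed

text \<open>The two sides have degrees in the intervals of length \<open>r\<close> starting at
  \<open>u * r\<close> and \<open>v * r\<close>, which forces \<open>u = v\<close>. A nonzero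
  difference of the top blocks would then have degree at least \<open>u * r\<close>, more than the
  remainders allow.\<close>

lemma shifted_eq_imp_eq:
  fixes U V E1 E2 :: "'a::idom poly"
  assumes eq: "monom 1 (u * r) * U + E1 = monom 1 (v * r) * V + E2"
    and U: "U \<in> polys_below r" "U \<noteq> 0" and V: "V \<in> polys_below r" "V \<noteq> 0"
    and E: "E1 \<in> polys_below (u * r)" "E2 \<in> polys_below (v * r)"
  shows "U = V"
proof -
  have deg: "u * r \<le> degree (monom 1 (u * r) * U + E1) \<and> degree (monom 1 (u * r) * U + E1) < Suc u * r"
    if "U \<in> polys_below r" "U \<noteq> 0" "E1 \<in> polys_below (u * r)" for u U and E1 :: "'a poly"
  proof -
    have d: "degree (monom 1 (u * r) * U) = u * r + degree U"
      using that by (simp add: degree_mult_eq degree_monom_eq monom_eq_0_iff)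
    have "degree (monom 1 (u * r) * U + E1) = u * r + degree U"
    proof (cases "E1 = 0")
      case False
      then have "degree E1 < degree (monom 1 (u * r) * U)" using that d by (auto simp: polys_below_iff)
      then show ?thesis using d by (simp add: degree_add_eq_left)
    qed (simp add: d)
    then show ?thesis using that by (auto simp: polys_below_iff)
  qed
  have "u * r < Suc v * r" "v * r < Suc u * r"
    using deg[OF U E(1)] deg[OF V E(2)] eq by simp_all
  then have uv: "u = v" by (metis mult_less_cancel2 less_Suc_eq not_less_eq linorder_neqE_nat)
  have "monom 1 (u * r) * (U - V) = E2 - E1" using eq uv by (simp add: algebra_simps)
  then have "monom 1 (u * r) * (U - V) \<in> polys_below (u * r)"
    using E uv by (simp add: polys_below_diff)
  then have "U - V = 0"
    by (cases "U - V = 0") (simp_all add: polys_below_iff degree_mult_eq degree_monom_eq monom_eq_0_iff)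
  then show ?thesis by simp
qed

lemma square_expand:
  fixes x a w f :: "'a::comm_ring_1"
  shows "(x * a + w)\<^sup>2 * f = x * x * (a * a * f) + (2 * x * a * w + w * w) * f"
  by (simp add: power2_eq_square algebra_simps)

lemma square_expand':
  fixes x a w m f :: "'a::comm_ring_1"
  shows "(x * a + w)\<^sup>2 * (m + f) = x * x * m * (a * a) + (a * a * (x * x) * f + (2 * x * a * w + w * w) * (m + f))"
  by (simp add: power2_eq_square algebra_simps)

text \<open>
  If \<open>R\<close> vanished, then \<open>S\<^sub>a\<^sup>2 f = S\<^sub>b\<^sup>2 f(T\<^sup>r)\<close> for the block sums \<open>S\<^sub>a\<close> and \<open>S\<^sub>b\<close> of the \<open>a j\<close> and \<open>b j\<close>. Comparing
  the top blocks of both sides gives \<open>a\<^sup>2 f = b\<^sup>2\<close>, as \<open>f\<close> is monic.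
\<close>

lemma stepanov_nonzero:
  fixes f :: "'a::{finite,field_gcd} poly"
  assumes f: "lead_coeff f = 1" "\<nexists>w. f = w\<^sup>2" and r: "r = CARD('a) ^ k" "r = 2 * B + 1"
    and A: "2 * A + degree f < r" "A > 0"
    and ab: "\<And>j. a j \<in> polys_below A" "\<And>j. b j \<in> polys_below A" "\<exists>j<J. a j \<noteq> 0 \<or> b j \<noteq> 0"
  shows "(\<Sum>j<J. monom 1 (j * r) * (a j + b j * f ^ B)) \<noteq> 0"
proof
  assume zero: "(\<Sum>j<J. monom 1 (j * r) * (a j + b j * f ^ B)) = 0"
  define Sa where "Sa = (\<Sum>j<J. monom 1 (j * r) * a j)"
  define Sb where "Sb = (\<Sum>j<J. monom 1 (j * r) * b j)"
  let ?m = "degree f"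
  have f0: "f \<noteq> 0" using f by auto
  have m: "?m > 0"
  proof (rule ccontr)
    assume "\<not> ?m > 0"
    then have "f = 1" using f(1) by (intro monic_degree_0_eq_1) auto
    then show False using f(2) by (metis one_power2)
  qed
  have lin: "Sa + Sb * f ^ B = 0"
    using zero by (simp add: Sa_def Sb_def sum.distrib ring_distribs sum_distrib_right mult.assoc)
  have nz: "Sw \<noteq> 0" if wnz: "\<exists>j<J. w j \<noteq> 0" and wA: "\<And>j. w j \<in> polys_below A"
    and Sw: "Sw = (\<Sum>j<J. monom 1 (j * r) * w j)" for w :: "nat \<Rightarrow> 'a poly" and Sw
  proof
    assume "Sw = 0"
    have "A \<le> r" using A by simp
    from block_sum_split[OF wA this wnz] obtain i W where
      i: "w i \<noteq> 0" "Sw = monom 1 (i * r) * w i + W" "W \<in> polys_below (i * r + A - r)"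
      unfolding Sw by metis
    have "monom 1 (i * r) * w i = - W" using i \<open>Sw = 0\<close> by (simp add: eq_neg_iff_add_eq_0)
    then have "monom 1 (i * r) * w i \<in> polys_below (i * r + A - r)" using i(3) by (simp add: polys_below_uminus)
    then show False using i(1) A by (auto simp: polys_below_iff degree_mult_eq degree_monom_eq monom_eq_0_iff)
  qed
  have a0: "\<exists>j<J. a j \<noteq> 0" 
  proof (rule ccontr)
    assume no: "\<not> ?thesis"
    then have "Sa = 0" by (simp add: Sa_def)
    then have "Sb = 0" using lin f0 by simp
    then show False using nz[OF _ ab(2) Sb_def] ab(3) no by auto
  qed
  have b0: "\<exists>j<J. b j \<noteq> 0" 
  proof (rule ccontr)
    assume no: "\<not> ?thesis"
    then have "Sb = 0" by (simp add: Sb_def)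
    then have "Sa = 0" using lin by simp
    then show False using nz[OF _ ab(1) Sa_def] ab(3) no by auto
  qed
  have Ar: "A \<le> r" using A by simp
  obtain i Wa where i: "a i \<noteq> 0" "Sa = monom 1 (i * r) * a i + Wa" "Wa \<in> polys_below (i * r + A - r)"
    using block_sum_split[OF ab(1) Ar a0] unfolding Sa_def by metis
  obtain l Wb where l: "b l \<noteq> 0" "Sb = monom 1 (l * r) * b l + Wb" "Wb \<in> polys_below (l * r + A - r)"
    using block_sum_split[OF ab(2) Ar b0] unfolding Sb_def by metis
  define F where "F = f ^ r"
  have "degree (f - monom 1 ?m) < ?m"
  proof -
    have "degree (f - monom 1 ?m) \<le> ?m - 1"
      by (rule degree_le) (use f m in \<open>auto simp: coeff_eq_0\<close>)
    then show ?thesis using m by simp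
  qed
  \<comment> \<open>\<open>F\<close> is a polynomial in \<open>T^r\<close>. Removing its leading
    monomial lowers the degree by at least \<open>r\<close>, so all of \<open>F1\<close> ends up in
    the remainder.\<close>
  define F1 where "F1 = pcompose (f - monom 1 ?m) (monom 1 r)"
  have F1: "F1 \<in> polys_below (Suc ((?m - 1) * r))"
    unfolding F1_def using \<open>degree (f - monom 1 ?m) < ?m\<close>
    by (intro polys_below_pcompose_monom) (auto simp: polys_below_iff)
  have F: "F = monom 1 (?m * r) + F1"
  proof -
    have "pcompose (monom 1 d) (monom 1 r) = (monom 1 (d * r) :: 'a poly)" for d
      by (induction d) (simp_all add: monom_Suc pcompose_pCons mult_monom pcompose_1)
    then show ?thesis unfolding F_def F1_def pcompose_diff r(1) poly_frobenius by simp
  qed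
  \<comment> \<open>Squaring and multiplying by \<open>f\<close> turns the half power into
    \<open>f ^ (2 * B + 1) = f ^ r\<close>, to which the Frobenius identity applies.\<close>
  have "Sa = - (Sb * f ^ B)" using lin by (simp add: eq_neg_iff_add_eq_0)
  then have "Sa\<^sup>2 * f = Sb\<^sup>2 * F"
    by (simp add: F_def r(2) power_mult_distrib power_add power_mult mult_ac)
  define E1 where "E1 = (2 * monom 1 (i * r) * a i * Wa + Wa * Wa) * f"
  define E2 where "E2 = b l * b l * monom 1 (2 * l * r) * F1 + (2 * monom 1 (l * r) * b l * Wb + Wb * Wb) * F"
  define U where "U = a i * a i * f"
  define V where "V = b l * b l"
  have "monom 1 (2 * i * r) * U + E1 = Sa\<^sup>2 * f"
  proof -
    have "monom 1 (2 * i * r) = monom 1 (i * r) * (monom 1 (i * r) :: 'a poly)"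
      by (simp add: mult_monom mult_2 distrib_right)
    then show ?thesis unfolding E1_def U_def i(2) by (simp only: square_expand)
  qed
  also have "\<dots> = Sb\<^sup>2 * F" by fact
  also have "\<dots> = monom 1 ((2 * l + ?m) * r) * V + E2"
  proof -
    have "monom 1 ((2 * l + ?m) * r) = monom 1 (l * r) * monom 1 (l * r) * (monom 1 (?m * r) :: 'a poly)"
      "monom 1 (2 * l * r) = monom 1 (l * r) * (monom 1 (l * r) :: 'a poly)"
      by (simp_all add: mult_monom mult_2 distrib_right add_ac)
    then show ?thesis unfolding E2_def V_def l(2) F by (simp only: square_expand')
  qed
  finally have eq: "monom 1 (2 * i * r) * U + E1 = monom 1 ((2 * l + ?m) * r) * V + E2" .
  have f_below: "f \<in> polys_below (Suc ?m)" by (simp add: polys_below_iff)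
  have F_below: "F \<in> polys_below (Suc (?m * r))"
    unfolding F by (intro polys_below_add monom_in_polys_below polys_below_mono[OF _ F1]) simp
  have "U = V"
  proof (rule shifted_eq_imp_eq[OF eq])
    \<comment> \<open>Here the hypothesis \<open>2 * A + degree f < r\<close> is decisive: even
      after multiplication by \<open>f\<close>, the squared block stays shorter than the
      spacing.\<close>
    show "U \<in> polys_below r" unfolding U_def
      by (rule polys_below_mult[OF polys_below_mult[OF ab(1) ab(1), where k = "2 * A - 1"] f_below])
         (use A in auto)
    show "V \<in> polys_below r" unfolding V_def
      by (rule polys_below_mult[OF ab(2) ab(2)]) (use A in auto)
    show "U \<noteq> 0" "V \<noteq> 0" using i l f0 by (auto simp: U_def V_def)
    show "E1 \<in> polys_below (2 * i * r)"
    \<comment> \<open>The bound \<open>i * r + A - r\<close> is an honest difference only for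
      \<open>i > 0\<close>. For \<open>i = 0\<close> there is no lower block.\<close>
    proof (cases "i = 0")
      case True
      then have "Wa = 0" using i(3) A by simp
      then show ?thesis by (simp add: E1_def)
    next
      case False
      define Z where "Z = i * r"
      have Z: "r \<le> Z" using False by (simp add: Z_def)
      have W: "Wa \<in> polys_below (Z + A - r)" using i(3) by (simp add: Z_def)
      have "a i * Wa \<in> polys_below (Z + 2 * A - r - 1)"
        by (rule polys_below_mult[OF ab(1) W]) (use A Z in auto)
      from polys_below_mult[OF this f_below, where k = "Z + 2 * A - r - 1 + ?m"]
      have "a i * Wa * f \<in> polys_below (Z + 2 * A - r - 1 + ?m)" by simp
      from polys_below_mult[OF monom_in_polys_below[of "2::'a" Z] this, where k = "2 * Z"]
      have 1: "monom 2 Z * (a i * Wa * f) \<in> polys_below (2 * Z)" using A Z by simp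
      have "Wa * Wa \<in> polys_below (2 * Z + 2 * A - 2 * r - 1)"
        by (rule polys_below_mult[OF W W]) (use A Z in auto)
      from polys_below_mult[OF this f_below, where k = "2 * Z"]
      have 2: "Wa * Wa * f \<in> polys_below (2 * Z)" using A Z by simp
      have "E1 = monom 2 Z * (a i * Wa * f) + Wa * Wa * f"
      proof -
        have "monom 2 Z = 2 * (monom 1 Z :: 'a poly)" by (simp add: numeral_poly smult_monom)
        then show ?thesis unfolding E1_def Z_def by (simp add: distrib_right distrib_left mult_ac)
      qed
      then show ?thesis using polys_below_add[OF 1 2] by (simp add: Z_def mult.assoc)
    qed
    show "E2 \<in> polys_below ((2 * l + ?m) * r)"
    proof -
      define Y where "Y = l * r"
      define M where "M = ?m * r"
      have M: "r \<le> M" using m by (simp add: M_def)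
      have F1': "F1 \<in> polys_below (Suc (M - r))" using F1 by (simp add: M_def diff_mult_distrib)
      have F': "F \<in> polys_below (Suc M)" using F_below by (simp add: M_def)
      have bb: "b l * b l \<in> polys_below (2 * A - 1)"
        by (rule polys_below_mult[OF ab(2) ab(2)]) (use A in auto)
      have "monom 1 (2 * Y) * F1 \<in> polys_below (2 * Y + M - r + 1)"
        by (rule polys_below_mult[OF monom_in_polys_below F1']) (use M in auto)
      from polys_below_mult[OF bb this, where k = "2 * Y + M"]
      have 0: "b l * b l * (monom 1 (2 * Y) * F1) \<in> polys_below (2 * Y + M)" using A M by simp
      have E2: "E2 = b l * b l * (monom 1 (2 * Y) * F1) + (monom 2 Y * (b l * Wb * F) + Wb * Wb * F)"
      proof -
        have "monom 2 Y = 2 * (monom 1 Y :: 'a poly)" by (simp add: numeral_poly smult_monom)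
        then show ?thesis unfolding E2_def Y_def by (simp add: distrib_right distrib_left add_ac mult_ac)
      qed
      have "monom 2 Y * (b l * Wb * F) + Wb * Wb * F \<in> polys_below (2 * Y + M)"
      proof (cases "l = 0")
        case True
        then have "Wb = 0" using l(3) A by simp
        then show ?thesis by simp
      next
        case False
        have Y: "r \<le> Y" using False by (simp add: Y_def)
        have W: "Wb \<in> polys_below (Y + A - r)" using l(3) by (simp add: Y_def)
        have "b l * Wb \<in> polys_below (Y + 2 * A - r - 1)"
          by (rule polys_below_mult[OF ab(2) W]) (use A Y in auto)
        from polys_below_mult[OF this F', where k = "Y + 2 * A - r - 1 + M"]
        have "b l * Wb * F \<in> polys_below (Y + 2 * A - r - 1 + M)" by simp
        from polys_below_mult[OF monom_in_polys_below[of "2::'a" Y] this, where k = "2 * Y + M"]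
        have 1: "monom 2 Y * (b l * Wb * F) \<in> polys_below (2 * Y + M)" using A Y by simp
        have "Wb * Wb \<in> polys_below (2 * Y + 2 * A - 2 * r - 1)"
          by (rule polys_below_mult[OF W W]) (use A Y in auto)
        from polys_below_mult[OF this F', where k = "2 * Y + M"]
        have 2: "Wb * Wb * F \<in> polys_below (2 * Y + M)" using A Y by simp
        show ?thesis by (rule polys_below_add[OF 1 2])
      qed
      from polys_below_add[OF 0 this] show ?thesis
        unfolding E2 by (simp add: Y_def M_def algebra_simps)
    qed
  qed
  then have sq: "(a i)\<^sup>2 * f = (b l)\<^sup>2" by (simp add: U_def V_def power2_eq_square)
  then have "(a i)\<^sup>2 dvd (b l)\<^sup>2" by (metis dvd_triv_left)
  then have "a i dvd b l" by simp
  then obtain w where "b l = a i * w" by (rule dvdE)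
  then have "f = w\<^sup>2" using sq i(1) by (simp add: power_mult_distrib)
  then show False using f(2) by blast
qed

lemma prod_dvd_of_coprime:
  fixes R :: "'a::{finite,field_gcd} poly"
  assumes "finite S" "\<And>P. P \<in> S \<Longrightarrow> P dvd R"
    "\<And>P P'. P \<in> S \<Longrightarrow> P' \<in> S \<Longrightarrow> P \<noteq> P' \<Longrightarrow> coprime P P'"
  shows "\<Prod>S dvd R"
  using assms
proof (induction S rule: finite_induct)
  case (insert P S)
  have "coprime P (\<Prod>S)" by (rule prod_coprime_right) (use insert in auto)
  then show ?case using insert by (simp add: divides_mult)
qed simp

lemma coprime_monic_irreducibles:
  fixes P P' :: "'a::{finite,field_gcd} poly"
  assumes "P \<in> monic_irreducibles_of_degree n" "P' \<in> monic_irreducibles_of_degree n'" "P \<noteq> P'"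
  shows "coprime P P'"
proof -
  have P: "irreducible P" "lead_coeff P = 1" and P': "irreducible P'" "lead_coeff P' = 1"
    using assms by (auto simp: monic_irreducibles_of_degree_def)
  have "\<not> P dvd P'"
  proof
    assume "P dvd P'"
    then obtain u where u: "P' = P * u" by (rule dvdE)
    then have "is_unit u" using P P' by (auto dest!: irreducibleD[OF P'(1)] simp: irreducible_not_unit)
    moreover have "lead_coeff u = 1" using arg_cong[OF u, of lead_coeff] P P' by (simp add: lead_coeff_mult)
    ultimately have "u = 1"
      by (metis monic_degree_0_eq_1 is_unit_iff_degree not_is_unit_0)
    then show False using u assms by simp
  qed
  then show ?thesis using P by (intro prime_elem_imp_coprime irreducible_imp_prime_elem)
qed

lemma finite_monic_irreducibles [simp]:
  "finite (monic_irreducibles_of_degree n :: 'a::{finite,field_gcd} poly set)"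
  by (rule finite_subset[OF _ finite_monic_of_degree[of n]])
     (auto simp: monic_irreducibles_of_degree_def monic_of_degree_def)

lemma stepanov_bound:
  fixes f :: "'a::{finite,field_gcd} poly"
  assumes odd: "odd CARD('a)" and g: "g > 0" and f: "lead_coeff f = 1" "\<nexists>w. f = w\<^sup>2"
    and m: "degree f \<le> 2 * g" and \<sigma>: "\<sigma> \<in> {1, -1}"
  defines "S \<equiv> {P \<in> monic_irreducibles_of_degree (2 * g + 1). qr_symbol f P = \<sigma>}"
  shows "2 * (2 * g + 1) * card S \<le> CARD('a) ^ (2 * g + 1) + 3 * degree f * CARD('a) ^ (g + 1)"
proof -
  let ?q = "CARD('a)" and ?m = "degree f"
  have q3: "?q \<ge> 3" by (rule card_ge_3[OF odd])
  \<comment> \<open>The residue field has \<open>r * r'\<close> elements. The larger factor spaces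
    the blocks, so that \<open>2 * A + degree f < r'\<close> even for degree \<open>2 * g\<close>;
    the smaller one is the power of Frobenius that is applied.\<close>
  define r where "r = ?q ^ g"
  define r' where "r' = ?q ^ (g + 1)"
  have "odd r" "odd r'" using odd by (simp_all add: r_def r'_def)
  then obtain A B where A: "r = 2 * A + 1" and B: "r' = 2 * B + 1" by (auto elim!: oddE)
  have rg: "r > g" 
  proof -
    have "g < 2 ^ g" by (rule less_exp)
    also have "\<dots> \<le> ?q ^ g" using q3 by (intro power_mono) auto
    finally show ?thesis by (simp add: r_def)
  qed
  have r'r: "r' \<ge> 3 * r" using q3 by (simp add: r_def r'_def)
  have A0: "A > 0" using rg g A by simp
  have bound: "2 * A + ?m < r'" using A rg r'r m by linarith
  obtain a b where ab: "\<And>j. a j \<in> polys_below A" "\<And>j. b j \<in> polys_below A" "\<exists>j<A + ?m + 1. a j \<noteq> 0 \<or> b j \<noteq> 0"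
    "(\<Sum>j<A + ?m + 1. monom 1 j * (pcompose (a j) (monom 1 r) * f ^ A + smult (of_int \<sigma>) (pcompose (b j) (monom 1 r)))) = 0"
    by (rule stepanov_coefficients[OF A0 A, where \<sigma> = "of_int \<sigma>" and f = f]) (rule that)
  define J where "J = A + ?m + 1"
  define R where "R = (\<Sum>j<J. monom 1 (j * r') * (a j + b j * f ^ B))"
  have R0: "R \<noteq> 0" unfolding R_def
    by (rule stepanov_nonzero[OF f r'_def B bound A0 ab(1,2)]) (use ab(3) in \<open>simp add: J_def\<close>)
  have dvd: "P dvd R" if "P \<in> S" for P
  proof -
    have P: "irreducible P" "lead_coeff P = 1" "degree P = 2 * g + 1" "qr_symbol f P = \<sigma>"
      using that by (auto simp: S_def monic_irreducibles_of_degree_def)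
    obtain \<alpha> where "prime_root P \<alpha>" using P(1,2) by (rule ex_prime_root)
    then interpret prime_root P \<alpha> .
    have Q: "?q ^ degree P = r' * r" by (simp add: P r_def r'_def power_add[symmetric] mult_2)
    define x where "x = ev f \<alpha>"
    \<comment> \<open>This explains the factor \<open>f ^ A\<close>: the \<open>r\<close>-th power
      of \<open>f ^ B\<close> contributes exponent \<open>B * r\<close>, and exactly
      \<open>A\<close> is missing to reach Euler's exponent.\<close>
    have "(r' * r - 1) div 2 = A + B * r"
      using A B by (simp add: algebra_simps)
    then have x: "x ^ A * x ^ (B * r) = of_int \<sigma>"
      using euler_criterion[OF odd, of f] by (simp add: P(4) x_def Q flip: power_add)
    have alpha: "\<alpha> ^ (r' * r) = \<alpha>" using K_power[OF ev_in_K[of "[:0, 1:]"]] by (simp add: Q)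
    have pow_add: "(u + v) ^ r = u ^ r + v ^ r" for u v :: "'a alg_closure"
      unfolding r_def by (rule power_card_add_ac)
    have pow_sum: "(\<Sum>i\<in>I. h i) ^ r = (\<Sum>i\<in>I. h i ^ r)" for h :: "nat \<Rightarrow> 'a alg_closure" and I
    proof -
      have "r > 0" using A by simp
      then show ?thesis by (induction I rule: infinite_finite_induct) (simp_all add: pow_add zero_power)
    qed
    have ev_r: "ev h \<alpha> ^ r = ev (pcompose h (monom 1 r)) \<alpha>" for h
      unfolding r_def by (metis poly_frobenius ev_power)
    have summand: "ev (monom 1 (j * r') * (a j + b j * f ^ B)) \<alpha> ^ r =
        \<alpha> ^ j * (ev (pcompose (a j) (monom 1 r)) \<alpha> + ev (pcompose (b j) (monom 1 r)) \<alpha> * x ^ (B * r))" for j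
    proof -
      have "(\<alpha> ^ (j * r')) ^ r = (\<alpha> ^ (r' * r)) ^ j" by (simp add: mult_ac flip: power_mult)
      then show ?thesis by (simp add: power_mult_distrib pow_add ev_r alpha x_def flip: power_mult)
    qed
    have "x ^ A * ev R \<alpha> ^ r = (\<Sum>j<J. \<alpha> ^ j * (ev (pcompose (a j) (monom 1 r)) \<alpha> * x ^ A
        + ev (pcompose (b j) (monom 1 r)) \<alpha> * (x ^ A * x ^ (B * r))))"
      unfolding R_def ev_sum pow_sum summand by (simp add: sum_distrib_left algebra_simps)
    also have "\<dots> = ev (\<Sum>j<J. monom 1 j * (pcompose (a j) (monom 1 r) * f ^ A + smult (of_int \<sigma>) (pcompose (b j) (monom 1 r)))) \<alpha>"
      unfolding x by (simp add: ev_sum x_def algebra_simps)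
    also have "\<dots> = 0" using ab(4) by (simp add: J_def)
    finally have "x ^ A = 0 \<or> ev R \<alpha> ^ r = 0" by simp
    moreover have "x ^ A \<noteq> 0" using x \<sigma> A0 by (auto simp: zero_power)
    ultimately show ?thesis by (auto simp: dvd_iff_ev)
  qed
  have finS: "finite S" by (simp add: S_def)
  have "\<Prod>S dvd R"
    by (rule prod_dvd_of_coprime[OF finS dvd])
       (auto simp: S_def intro: coprime_monic_irreducibles)
  then have "degree (\<Prod>S) \<le> degree R" using R0 by (rule dvd_imp_degree_le)
  moreover have "degree (\<Prod>S) = (2 * g + 1) * card S"
  proof -
    have "degree (\<Prod>S) = (\<Sum>P\<in>S. degree P)"
      by (rule degree_prod_eq_sum_degree) (auto simp: S_def monic_irreducibles_of_degree_def)
    also have "\<dots> = (\<Sum>P\<in>S. 2 * g + 1)"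
      by (rule sum.cong) (auto simp: S_def monic_irreducibles_of_degree_def)
    finally show ?thesis by simp
  qed
  moreover have "R \<in> polys_below (Suc ((A + ?m) * r' + A + ?m * B))"
    unfolding R_def
  proof (rule polys_below_sum)
    fix j assume "j \<in> {..<J}"
    then have j: "j * r' \<le> (A + ?m) * r'" by (intro mult_right_mono) (auto simp: J_def)
    have "f ^ B \<in> polys_below (Suc (?m * B))"
      using degree_power_le[of f B] by (auto simp: polys_below_iff)
    from polys_below_mult[OF ab(2)[of j] this, where k = "A + ?m * B"]
    have "a j + b j * f ^ B \<in> polys_below (A + ?m * B)"
      by (intro polys_below_add polys_below_mono[OF _ ab(1)[of j]]) auto
    then show "monom 1 (j * r') * (a j + b j * f ^ B) \<in> polys_below (Suc ((A + ?m) * r' + A + ?m * B))"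
      by (rule polys_below_mult[OF monom_in_polys_below]) (use j in linarith)
  qed
  ultimately have "(2 * g + 1) * card S \<le> (A + ?m) * r' + A + ?m * B"
    using R0 by (auto simp: polys_below_iff)
  then have "2 * (2 * g + 1) * card S \<le> 2 * A * r' + 2 * ?m * r' + 2 * A + ?m * (2 * B)"
    by (simp add: algebra_simps)
  \<comment> \<open>Both \<open>2 * A\<close> and \<open>2 * B\<close> are below \<open>r'\<close>.
    The first completes the leading term to \<open>r * r'\<close>; the second makes the coefficient
    3.\<close>
  also have "\<dots> \<le> (2 * A * r' + r') + 3 * ?m * r'"
    using B A r'r by (simp add: algebra_simps)
  also have "2 * A * r' + r' = ?q ^ (2 * g + 1)"
  proof -
    have "2 * A * r' + r' = r * r'" by (simp add: A)
    also have "\<dots> = ?q ^ (2 * g + 1)" by (simp add: r_def r'_def power_add[symmetric] mult_2)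
    finally show ?thesis .
  qed
  finally show ?thesis by (simp add: r'_def)
qed

section \<open>Sums of residue symbols over primes\<close>

lemma card_multiples_monic:
  fixes h :: "'a::{finite,field_gcd} poly"
  assumes h: "lead_coeff h = 1"
  shows "card {f \<in> monic_of_degree n. h dvd f} = (if degree h \<le> n then CARD('a) ^ (n - degree h) else 0)"
proof (cases "degree h \<le> n")
  case True
  have h0: "h \<noteq> 0" using h by auto
  have "{f \<in> monic_of_degree n. h dvd f} = (\<lambda>k. h * k) ` monic_of_degree (n - degree h)"
  proof (intro equalityI subsetI)
    fix f assume f: "f \<in> {f \<in> monic_of_degree n. h dvd f}"
    then obtain k where k: "f = h * k" by (auto elim: dvdE)
    have "lead_coeff k = 1" using f k h by (auto simp: monic_of_degree_def lead_coeff_mult)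
    moreover from this have "k \<noteq> 0" by auto
    ultimately have "k \<in> monic_of_degree (n - degree h)"
      using f h0 k by (auto simp: monic_of_degree_def degree_mult_eq)
    then show "f \<in> (\<lambda>k. h * k) ` monic_of_degree (n - degree h)" unfolding k by (rule imageI)
  next
    fix f assume "f \<in> (\<lambda>k. h * k) ` monic_of_degree (n - degree h)"
    then obtain k where "f = h * k" "k \<in> monic_of_degree (n - degree h)" by blast
    then have k: "f = h * k" "lead_coeff k = 1" "degree k = n - degree h"
      by (auto simp: monic_of_degree_def)
    from this have "k \<noteq> 0" by auto
    then have "degree f = n" using k h0 True by (simp add: degree_mult_eq)
    moreover have "lead_coeff f = 1" unfolding k(1) lead_coeff_mult using k h by simp
    ultimately show "f \<in> {f \<in> monic_of_degree n. h dvd f}" using k by (simp add: monic_of_degree_def)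
  qed
  moreover have "inj_on (\<lambda>k. h * k) (monic_of_degree (n - degree h))"
    using h0 by (auto simp: inj_on_def)
  ultimately show ?thesis using True by (simp add: card_image card_monic_of_degree)
next
  case False
  have "{f \<in> monic_of_degree n. h dvd f} = {}"
    using False by (auto simp: monic_of_degree_def dest!: dvd_imp_degree_le)
  then show ?thesis using False by simp
qed

text \<open>
  Summing \<open>degree f\<close> over all monic \<open>f\<close> of degree \<open>n\<close>, with \<open>degree f\<close> written as a sum over the prime powers
  dividing \<open>f\<close>, and subtracting \<open>q\<close> times the same identity for \<open>n - 1\<close> isolates the primes whose degree
  divides \<open>n\<close>.
\<close>

definition irreducibles_upto :: "nat \<Rightarrow> 'a::{finite,field_gcd} poly set" where
  "irreducibles_upto n = (\<Union>d\<le>n. monic_irreducibles_of_degree d)"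

lemma finite_irreducibles_upto [simp]: "finite (irreducibles_upto n)"
  by (simp add: irreducibles_upto_def)

lemma irreducibles_upto_iff:
  "P \<in> irreducibles_upto n \<longleftrightarrow> lead_coeff P = 1 \<and> irreducible P \<and> degree P \<le> n"
  by (auto simp: irreducibles_upto_def monic_irreducibles_of_degree_def)

lemma monic_irreducible_imp_prime:
  fixes P :: "'a::{finite,field_gcd} poly"
  assumes "irreducible P" "lead_coeff P = 1"
  shows "prime P"
proof -
  have "normalize P = P" using assms(2) by (rule normalize_monic)
  then show ?thesis using assms(1)
    by (simp add: prime_def irreducible_imp_prime_elem)
qed

lemma degree_eq_sum_prime_powers:
  fixes f :: "'a::{finite,field_gcd} poly"
  assumes f: "f \<in> monic_of_degree n"
  shows "n = (\<Sum>P\<in>irreducibles_upto n. \<Sum>k\<in>{1..n}. if P ^ k dvd f then degree P else 0)"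
proof -
  have f0: "f \<noteq> 0" and deg: "degree f = n" and lc: "lead_coeff f = 1"
    using f by (auto simp: monic_of_degree_def)
  have mult: "(\<Sum>k\<in>{1..n}. if P ^ k dvd f then degree P else 0) = multiplicity P f * degree P"
    if P: "irreducible P" for P
  proof -
    have nu: "\<not> is_unit P" using P by (simp add: irreducible_not_unit)
    have *: "P ^ k dvd f \<longleftrightarrow> k \<le> multiplicity P f" for k
      using f0 nu by (simp add: power_dvd_iff_le_multiplicity)
    have "P ^ multiplicity P f dvd f" by (rule multiplicity_dvd)
    then have "degree (P ^ multiplicity P f) \<le> n" using dvd_imp_degree_le f0 deg by blast
    then have "multiplicity P f * degree P \<le> n" 
      using irreducible_degree_pos[OF P] by (subst (asm) degree_power_eq) auto
    moreover have "multiplicity P f * 1 \<le> multiplicity P f * degree P"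
      by (rule mult_left_mono) (use irreducible_degree_pos[OF P] in auto)
    ultimately have "multiplicity P f \<le> n" by linarith
    then have "{k \<in> {1..n}. P ^ k dvd f} = {1..multiplicity P f}" by (auto simp: *)
    moreover have "(\<Sum>k\<in>{1..n}. if P ^ k dvd f then degree P else 0) = (\<Sum>k\<in>{k \<in> {1..n}. P ^ k dvd f}. degree P)"
      by (rule sum.inter_filter[symmetric]) simp
    ultimately show ?thesis by simp
  qed
  have sub: "prime_factors f \<subseteq> irreducibles_upto n"
  proof
    fix p assume p: "p \<in># prime_factorization f"
    then have pp: "prime p" "p dvd f" by (auto simp: in_prime_factors_iff)
    then show "p \<in> irreducibles_upto n"
      using deg f0 dvd_imp_degree_le[of p f] lead_coeff_prime[of p] by (simp add: irreducibles_upto_iff prime_elem_imp_irreducible)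
  qed
  have "f = (\<Prod>p\<in>prime_factors f. p ^ multiplicity p f)"
    using prod_prime_factors[OF f0] lc by (simp add: normalize_monic)
  then have "degree f = degree (\<Prod>p\<in>prime_factors f. p ^ multiplicity p f)" by simp
  also have "\<dots> = (\<Sum>p\<in>prime_factors f. degree (p ^ multiplicity p f))"
    by (rule degree_prod_eq_sum_degree) auto
  also have "\<dots> = (\<Sum>p\<in>prime_factors f. multiplicity p f * degree p)"
    by (intro sum.cong) (auto simp: degree_power_eq in_prime_factors_iff)
  also have "\<dots> = (\<Sum>p\<in>irreducibles_upto n. multiplicity p f * degree p)"
  proof (rule sum.mono_neutral_left[OF _ sub])
    show "\<forall>p\<in>irreducibles_upto n - prime_factors f. multiplicity p f * degree p = 0"
    proof
      fix p assume p: "p \<in> irreducibles_upto n - prime_factors f"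
      then have "\<not> p dvd f" using f0
        by (auto simp: in_prime_factors_iff irreducibles_upto_iff monic_irreducible_imp_prime)
      then show "multiplicity p f * degree p = 0" by (simp add: not_dvd_imp_multiplicity_0)
    qed
  qed simp
  also have "\<dots> = (\<Sum>P\<in>irreducibles_upto n. \<Sum>k\<in>{1..n}. if P ^ k dvd f then degree P else 0)"
    by (rule sum.cong[OF refl], rule mult[symmetric]) (simp add: irreducibles_upto_iff)
  finally show ?thesis unfolding deg .
qed

text \<open>The ranges are widened from \<open>n\<close> to \<open>N\<close> by zero terms, so that
  the identities for \<open>n\<close> and \<open>n - 1\<close> can be subtracted term by
  term.\<close>

lemma prime_power_count_weighted:
  assumes "n \<le> N"
  shows "n * CARD('a::{finite,field_gcd}) ^ n =
    (\<Sum>P\<in>(irreducibles_upto N :: 'a poly set). \<Sum>k\<in>{1..N}. if k * degree P \<le> n then degree P * CARD('a) ^ (n - k * degree P) else 0)"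
proof -
  let ?I = "irreducibles_upto n :: 'a poly set" and ?J = "irreducibles_upto N :: 'a poly set"
  have "n * CARD('a) ^ n = (\<Sum>f\<in>(monic_of_degree n :: 'a poly set). n)"
    by (simp add: card_monic_of_degree)
  also have "\<dots> = (\<Sum>f\<in>(monic_of_degree n :: 'a poly set). \<Sum>P\<in>?I. \<Sum>k\<in>{1..n}. if P ^ k dvd f then degree P else 0)"
    by (rule sum.cong[OF refl]) (rule degree_eq_sum_prime_powers)
  also have "\<dots> = (\<Sum>P\<in>?I. \<Sum>k\<in>{1..n}. \<Sum>f\<in>monic_of_degree n. if P ^ k dvd f then degree P else 0)"
    by (subst sum.swap, rule sum.cong[OF refl], rule sum.swap)
  also have "\<dots> = (\<Sum>P\<in>?I. \<Sum>k\<in>{1..n}. if k * degree P \<le> n then degree P * CARD('a) ^ (n - k * degree P) else 0)"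
  proof (intro sum.cong refl)
    fix P :: "'a poly" and k assume P: "P \<in> ?I"
    then have P': "lead_coeff P = 1" "P \<noteq> 0" by (auto simp: irreducibles_upto_iff)
    have "(\<Sum>f\<in>monic_of_degree n. if P ^ k dvd f then degree P else 0) = card {f \<in> monic_of_degree n. P ^ k dvd f} * degree P"
      by (simp flip: sum.inter_filter)
    also have "\<dots> = (if k * degree P \<le> n then degree P * CARD('a) ^ (n - k * degree P) else 0)"
    proof -
      have "lead_coeff (P ^ k) = 1" by (simp only: lead_coeff_power P' power_one)
      then show ?thesis using P' by (subst card_multiples_monic) (auto simp: degree_power_eq)
    qed
    finally show "(\<Sum>f\<in>monic_of_degree n. if P ^ k dvd f then degree P else 0) =
      (if k * degree P \<le> n then degree P * CARD('a) ^ (n - k * degree P) else 0)" .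
  qed
  also have "\<dots> = (\<Sum>P\<in>?I. \<Sum>k\<in>{1..N}. if k * degree P \<le> n then degree P * CARD('a) ^ (n - k * degree P) else 0)"
  proof (rule sum.cong[OF refl], rule sum.mono_neutral_left)
    fix P :: "'a poly" assume "P \<in> ?I"
    then have "degree P > 0" by (auto simp: irreducibles_upto_iff irreducible_degree_pos)
    then have "k \<le> n" if "k * degree P \<le> n" for k
      using that by (metis dual_order.trans le_add1 mult.commute mult_Suc Suc_pred)
    then show "\<forall>k\<in>{1..N} - {1..n}. (if k * degree P \<le> n then degree P * CARD('a) ^ (n - k * degree P) else 0) = 0"
      by auto
  qed (use assms in auto)
  also have "\<dots> = (\<Sum>P\<in>?J. \<Sum>k\<in>{1..N}. if k * degree P \<le> n then degree P * CARD('a) ^ (n - k * degree P) else 0)"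
  proof (rule sum.mono_neutral_left)
    show "?I \<subseteq> ?J" using assms by (auto simp: irreducibles_upto_iff)
    show "\<forall>P\<in>?J - ?I. (\<Sum>k\<in>{1..N}. if k * degree P \<le> n then degree P * CARD('a) ^ (n - k * degree P) else 0) = 0"
    proof
      fix P :: "'a poly" assume P: "P \<in> ?J - ?I"
      then have "degree P > n" by (auto simp: irreducibles_upto_iff)
      then have "\<not> k * degree P \<le> n" if "k \<ge> 1" for k
        using that by (metis dual_order.strict_trans1 le_add1 mult.commute mult_Suc_right not_less Suc_pred' One_nat_def Suc_le_eq)
      then show "(\<Sum>k\<in>{1..N}. if k * degree P \<le> n then degree P * CARD('a) ^ (n - k * degree P) else 0) = 0"
        by (intro sum.neutral) auto
    qed
  qed simp
  finally show ?thesis .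
qed

lemma prime_power_count:
  assumes "n > 0"
  shows "CARD('a::{finite,field_gcd}) ^ n =
    (\<Sum>P\<in>(irreducibles_upto n :: 'a poly set). \<Sum>k\<in>{1..n}. if k * degree P = n then degree P else 0)"
proof -
  let ?q = "CARD('a)" and ?I = "irreducibles_upto n :: 'a poly set"
  obtain m where m: "n = Suc m" using assms by (cases n) auto
  have "n * ?q ^ n = (\<Sum>P\<in>?I. \<Sum>k\<in>{1..n}. if k * degree P \<le> n then degree P * ?q ^ (n - k * degree P) else 0)"
    by (rule prime_power_count_weighted) simp
  also have "\<dots> = (\<Sum>P\<in>?I. \<Sum>k\<in>{1..n}. ?q * (if k * degree P \<le> m then degree P * ?q ^ (m - k * degree P) else 0)
       + (if k * degree P = n then degree P else 0))"
    by (intro sum.cong) (auto simp: m Suc_diff_le le_Suc_eq)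
  also have "\<dots> = ?q * (m * ?q ^ m) + (\<Sum>P\<in>?I. \<Sum>k\<in>{1..n}. if k * degree P = n then degree P else 0)"
  proof -
    have "m * ?q ^ m = (\<Sum>P\<in>?I. \<Sum>k\<in>{1..n}. if k * degree P \<le> m then degree P * ?q ^ (m - k * degree P) else 0)"
      by (rule prime_power_count_weighted) (simp add: m)
    then show ?thesis by (simp only: sum.distrib sum_distrib_left)
  qed
  finally show ?thesis by (simp add: m)
qed

lemma prime_count_le:
  "n * card (monic_irreducibles_of_degree n :: 'a::{finite,field_gcd} poly set) \<le> CARD('a) ^ n"
proof (cases "n = 0")
  case False
  let ?I = "irreducibles_upto n :: 'a poly set"
  have "n * card (monic_irreducibles_of_degree n :: 'a poly set) = (\<Sum>P\<in>(monic_irreducibles_of_degree n :: 'a poly set). n)"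
    by simp
  also have "\<dots> \<le> (\<Sum>P\<in>(monic_irreducibles_of_degree n :: 'a poly set). \<Sum>k\<in>{1..n}. if k * degree P = n then degree P else 0)"
  proof (rule sum_mono)
    fix P :: "'a poly" assume "P \<in> monic_irreducibles_of_degree n"
    then have "n = (if 1 * degree P = n then degree P else 0)" by (simp add: monic_irreducibles_of_degree_def)
    also have "\<dots> \<le> (\<Sum>k\<in>{1..n}. if k * degree P = n then degree P else 0)"
      by (rule member_le_sum) (use False in auto)
    finally show "n \<le> (\<Sum>k\<in>{1..n}. if k * degree P = n then degree P else 0)" .
  qed
  also have "\<dots> \<le> (\<Sum>P\<in>?I. \<Sum>k\<in>{1..n}. if k * degree P = n then degree P else 0)"
    by (rule sum_mono2) (auto simp: irreducibles_upto_def)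
  also have "\<dots> = CARD('a) ^ n"
    by (rule prime_power_count[symmetric]) (use False in simp)
  finally show ?thesis .
qed simp

text \<open>A proper divisor of the odd number \<open>2 * g + 1\<close> has a cofactor of at least
  3, so it is at most \<open>g\<close>. The upper bound for the number of primes of these degrees
  leaves an error of at most \<open>1 + q + ... + q^g\<close>.\<close>

lemma prime_count_ge:
  assumes odd: "odd CARD('a::{finite,field_gcd})"
  shows "CARD('a) ^ (2 * g + 1) \<le> (2 * g + 1) * card (monic_irreducibles_of_degree (2 * g + 1) :: 'a poly set) + CARD('a) ^ (g + 1)"
proof -
  let ?q = "CARD('a)" and ?n = "2 * g + 1"
  let ?I = "irreducibles_upto ?n :: 'a poly set" and ?M = "\<lambda>d. monic_irreducibles_of_degree d :: 'a poly set"
  have le: "(\<Sum>k\<in>{1..?n}. if k * degree P = ?n then degree P else 0) \<le> (if degree P = ?n then ?n else if degree P \<le> g then degree P else 0)"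
    if P: "P \<in> ?I" for P
  proof -
    have d0: "degree P > 0" using P by (auto simp: irreducibles_upto_iff irreducible_degree_pos)
    have small: "degree P = ?n \<or> degree P \<le> g" if "k * degree P = ?n" for k
    proof -
      have "k \<noteq> 0" using that by (intro notI) simp
      moreover have "k = 1 \<or> k = 2 \<or> k \<ge> 3" using calculation by linarith
      moreover have "k * degree P \<ge> 3 * degree P" if "k \<ge> 3" using that by simp
      moreover have "k \<noteq> 2"
      proof
        assume "k = 2"
        then have "2 * degree P = 2 * g + 1" using that by simp
        then show False by presburger
      qed
      ultimately show ?thesis using that by (cases "k = 1") auto
    qed
    show ?thesis
    proof (cases "\<exists>k\<in>{1..?n}. k * degree P = ?n")
      case True
      then obtain k where k: "k \<in> {1..?n}" "k * degree P = ?n" by blast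
      have uniq: "j * degree P = ?n \<longleftrightarrow> j = k" for j using k(2) d0 by (metis mult_cancel2 not_gr0)
      have "(\<Sum>k\<in>{1..?n}. if k * degree P = ?n then degree P else 0) = degree P"
        unfolding uniq using k(1) by simp
      moreover have "degree P \<le> (if degree P = ?n then ?n else if degree P \<le> g then degree P else 0)"
        using small[OF k(2)] by (elim disjE) simp_all
      ultimately show ?thesis by (rule ord_eq_le_trans)
    next
      case False
      then have "(\<Sum>k\<in>{1..?n}. if k * degree P = ?n then degree P else 0) = 0" by (intro sum.neutral) auto
      then show ?thesis by (simp only: le0)
    qed
  qed
  have "?q ^ ?n = (\<Sum>P\<in>?I. \<Sum>k\<in>{1..?n}. if k * degree P = ?n then degree P else 0)"
    by (rule prime_power_count) simp
  also have "\<dots> \<le> (\<Sum>P\<in>?I. (if degree P = ?n then ?n else if degree P \<le> g then degree P else 0))"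
    by (intro sum_mono le)
  also have "\<dots> = (\<Sum>d\<le>?n. \<Sum>P\<in>?M d. (if degree P = ?n then ?n else if degree P \<le> g then degree P else 0))"
    unfolding irreducibles_upto_def
  proof (rule sum.UNION_disjoint)
    show "\<forall>i\<in>{..?n}. \<forall>j\<in>{..?n}. i \<noteq> j \<longrightarrow> ?M i \<inter> ?M j = {}"
      by (auto simp: monic_irreducibles_of_degree_def)
  qed simp_all
  also have "\<dots> = (\<Sum>d\<le>?n. (if d = ?n then ?n * card (?M ?n) else if d \<le> g then d * card (?M d) else 0))"
  proof (rule sum.cong[OF refl])
    fix d
    have "(\<Sum>P\<in>?M d. (if degree P = ?n then ?n else if degree P \<le> g then degree P else 0))
        = (\<Sum>P\<in>?M d. (if d = ?n then ?n else if d \<le> g then d else 0))"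
      by (intro sum.cong) (auto simp: monic_irreducibles_of_degree_def)
    then show "(\<Sum>P\<in>?M d. (if degree P = ?n then ?n else if degree P \<le> g then degree P else 0))
        = (if d = ?n then ?n * card (?M ?n) else if d \<le> g then d * card (?M d) else 0)"
      by simp
  qed
  also have "\<dots> = ?n * card (?M ?n) + (\<Sum>d\<le>2*g. if d \<le> g then d * card (?M d) else 0)"
    by simp
  also have "(\<Sum>d\<le>2*g. if d \<le> g then d * card (?M d) else 0) = (\<Sum>d\<le>g. d * card (?M d))"
    by (rule sum.mono_neutral_cong_right) auto
  also have "\<dots> \<le> (\<Sum>d\<le>g. ?q ^ d)" by (intro sum_mono prime_count_le)
  also have "\<dots> \<le> ?q ^ (g + 1)"
  proof -
    have "?q \<ge> 2" using card_ge_3[OF odd] by simp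
    then show ?thesis
    proof (induction g)
      case (Suc g)
      have "(\<Sum>d\<le>Suc g. ?q ^ d) \<le> ?q ^ (g + 1) + ?q ^ Suc g" using Suc.IH[OF Suc.prems] by simp
      also have "\<dots> = 2 * ?q ^ Suc g" by simp
      also have "\<dots> \<le> ?q * ?q ^ Suc g" using Suc.prems by (intro mult_right_mono) auto
      finally show ?case by simp
    qed simp
  qed
  finally show ?thesis by simp
qed

section \<open>Cancellation over primes for a nonsquare numerator\<close>

text \<open>Stepanov's method bounds each class from above only. As \<open>f\<close> has degree
  below that of \<open>P\<close>, no symbol is 0 and the two classes make up all primes, so the
  upper bound for one class is a lower bound for the other.\<close>

lemma prime_character_sum_bound:
  fixes f :: "'a::{finite,field_gcd} poly"
  assumes odd: "odd CARD('a)" and g: "g > 0" and f: "lead_coeff f = 1" "\<nexists>w. f = w\<^sup>2"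
    and m: "degree f \<le> 2 * g"
  shows "\<bar>\<Sum>P\<in>monic_irreducibles_of_degree (2 * g + 1). qr_symbol f P\<bar> \<le> 4 * int CARD('a) ^ (g + 1)"
proof -
  let ?q = "CARD('a)" and ?M = "monic_irreducibles_of_degree (2 * g + 1) :: 'a poly set"
  define Np where "Np = card {P \<in> ?M. qr_symbol f P = 1}"
  define Nm where "Nm = card {P \<in> ?M. qr_symbol f P = -1}"
  have vals: "qr_symbol f P = 1 \<or> qr_symbol f P = -1" if "P \<in> ?M" for P
  proof -
    have "f \<noteq> 0" using f by auto
    then have "\<not> P dvd f" using that m dvd_imp_degree_le[of P f] by (auto simp: monic_irreducibles_of_degree_def)
    then show ?thesis by (simp add: qr_symbol_def)
  qed
  have M: "?M = {P \<in> ?M. qr_symbol f P = 1} \<union> {P \<in> ?M. qr_symbol f P = -1}" using vals by auto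
  have card: "card ?M = Np + Nm"
    unfolding Np_def Nm_def by (subst M, subst card_Un_disjoint) auto
  have "(\<Sum>P\<in>?M. qr_symbol f P) = (\<Sum>P\<in>{P \<in> ?M. qr_symbol f P = 1}. qr_symbol f P) + (\<Sum>P\<in>{P \<in> ?M. qr_symbol f P = -1}. qr_symbol f P)"
    by (subst M, subst sum.union_disjoint) auto
  also have "\<dots> = int Np - int Nm" by (simp add: Np_def Nm_def)
  finally have sum: "(\<Sum>P\<in>?M. qr_symbol f P) = int Np - int Nm" .
  define Q where "Q = ?q ^ (2 * g + 1)"
  define R where "R = ?q ^ (g + 1)"
  have p: "2 * (2 * g + 1) * Np \<le> Q + 3 * degree f * R" and n: "2 * (2 * g + 1) * Nm \<le> Q + 3 * degree f * R"
    unfolding Np_def Nm_def Q_def R_def by (intro stepanov_bound[OF odd g f m]; simp)+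
  have low: "Q \<le> (2 * g + 1) * (Np + Nm) + R" unfolding Q_def R_def card[symmetric] by (rule prime_count_ge[OF odd])
  have "3 * degree f * R \<le> 6 * g * R" by (rule mult_right_mono) (use m in auto)
  then have up: "2 * (2 * g + 1) * Np \<le> Q + 6 * g * R" "2 * (2 * g + 1) * Nm \<le> Q + 6 * g * R"
    using p n by linarith+
  \<comment> \<open>Eliminating \<open>Q\<close> bounds \<open>(2 * g + 1) * (Np - Nm)\<close> by
    \<open>(6 * g + 1) * R\<close>, and likewise with the classes exchanged. The factor
    \<open>2 * g + 1\<close> divides out, so the degree of \<open>f\<close> leaves only a constant
    behind.\<close>
  have "(2 * g + 1) * Np \<le> (2 * g + 1) * (Nm + 4 * R)" "(2 * g + 1) * Nm \<le> (2 * g + 1) * (Np + 4 * R)"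
    using up low by (simp_all add: algebra_simps)
  then have "Np \<le> Nm + 4 * R" "Nm \<le> Np + 4 * R" by (simp_all only: mult_le_cancel1)
  moreover have "int CARD('a) ^ (g + 1) = int R" by (simp add: R_def)
  ultimately show ?thesis unfolding sum by linarith
qed

section \<open>Pairs of monic polynomials with square product\<close>

lemma lead_coeff_gcd:
  fixes p q :: "'a::field_gcd poly"
  shows "p \<noteq> 0 \<Longrightarrow> lead_coeff (gcd p q) = 1"
  by (simp add: unit_factor_gcd flip: unit_factor_eq_1_iff)

lemma lead_coeff_divide_monic:
  fixes p q :: "'a::field poly"
  assumes "lead_coeff (p * q) = 1" "lead_coeff p = 1"
  shows "lead_coeff q = 1"
  using assms by (simp add: lead_coeff_mult)

lemma monic_pairs_iff:
  "(f1, f2) \<in> monic_pairs k \<longleftrightarrow> lead_coeff f1 = 1 \<and> lead_coeff f2 = 1 \<and> degree f1 + degree f2 = k"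
  by (auto simp: monic_pairs_def monic_of_degree_def)

lemma finite_monic_pairs [simp]: "finite (monic_pairs k)"
  by (simp add: monic_pairs_def)

definition monic_triples :: "nat \<Rightarrow> ('a::{finite,field_gcd} poly \<times> 'a poly \<times> 'a poly) set" where
  "monic_triples k = {(x, y, z). lead_coeff x = 1 \<and> lead_coeff y = 1 \<and> lead_coeff z = 1
      \<and> degree x + degree y + degree z = k}"

definition coprime_triples :: "nat \<Rightarrow> ('a::{finite,field_gcd} poly \<times> 'a poly \<times> 'a poly) set" where
  "coprime_triples k = {(x, y, z) \<in> monic_triples k. coprime y z}"

lemma monic_triples_eq: "monic_triples k = (\<Union>i\<le>k. monic_of_degree i \<times> monic_pairs (k - i))"
  by (force simp: monic_triples_def monic_of_degree_def monic_pairs_iff)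

lemma finite_monic_triples [simp]: "finite (monic_triples k)"
  by (simp add: monic_triples_eq)

lemma finite_coprime_triples [simp]: "finite (coprime_triples k)"
  by (rule finite_subset[OF _ finite_monic_triples[of k]]) (auto simp: coprime_triples_def)

lemma card_monic_triples:
  "2 * card (monic_triples k :: ('a::{finite,field_gcd} poly \<times> 'a poly \<times> 'a poly) set)
    = (k + 1) * (k + 2) * CARD('a) ^ k"
proof -
  have "card (monic_triples k :: ('a poly \<times> 'a poly \<times> 'a poly) set)
      = (\<Sum>i\<le>k. card (monic_of_degree i \<times> monic_pairs (k - i) :: ('a poly \<times> 'a poly \<times> 'a poly) set))"
    unfolding monic_triples_eq
  proof (rule card_UN_disjoint)
    show "\<forall>i\<in>{..k}. \<forall>j\<in>{..k}. i \<noteq> j \<longrightarrow> (monic_of_degree i \<times> monic_pairs (k - i))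
        \<inter> (monic_of_degree j \<times> monic_pairs (k - j)) = ({} :: ('a poly \<times> 'a poly \<times> 'a poly) set)"
      by (auto simp: monic_of_degree_def)
  qed simp_all
  also have "\<dots> = (\<Sum>i\<le>k. (k - i + 1) * CARD('a) ^ k)"
  proof (rule sum.cong[OF refl])
    fix i assume "i \<in> {..k}"
    then have q: "CARD('a) ^ i * CARD('a) ^ (k - i) = CARD('a) ^ k" by (simp flip: power_add)
    show "card (monic_of_degree i \<times> monic_pairs (k - i) :: ('a poly \<times> 'a poly \<times> 'a poly) set)
        = (k - i + 1) * CARD('a) ^ k"
      unfolding card_cartesian_product card_monic_of_degree card_monic_pairs q[symmetric]
      by (simp only: mult_ac)
  qed
  also have "\<dots> = (\<Sum>i\<le>k. (k - i + 1)) * CARD('a) ^ k" by (simp only: sum_distrib_right)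
  also have "(\<Sum>i\<le>k. (k - i + 1)) = (\<Sum>i\<le>k. i + 1)"
    by (rule sum.reindex_bij_witness[of _ "\<lambda>i. k - i" "\<lambda>i. k - i"]) auto
  finally have "2 * card (monic_triples k :: ('a poly \<times> 'a poly \<times> 'a poly) set) = 2 * (\<Sum>i\<le>k. i + 1) * CARD('a) ^ k"
    by simp
  also have "2 * (\<Sum>i\<le>k. i + 1) = (k + 1) * (k + 2)"
    by (induction k) simp_all
  finally show ?thesis .
qed

text \<open>The common divisor of the last two entries is split off; degree \<open>j\<close> costs
  \<open>2 * j\<close> in total degree. In generating series: \<open>1 / (1 - q u^2)\<close> times
  the series of coprime triples is \<open>1 / (1 - q u)^3\<close>.\<close>

lemma card_monic_triples_gcd:
  "card (monic_triples k :: ('a::{finite,field_gcd} poly \<times> 'a poly \<times> 'a poly) set)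
    = (\<Sum>j\<le>k div 2. CARD('a) ^ j * card (coprime_triples (k - 2 * j) :: ('a poly \<times> 'a poly \<times> 'a poly) set))"
proof -
  let ?B = "SIGMA j:{..k div 2}. (monic_of_degree j :: 'a poly set) \<times> (coprime_triples (k - 2 * j) :: ('a poly \<times> 'a poly \<times> 'a poly) set)"
  have "card (monic_triples k :: ('a poly \<times> 'a poly \<times> 'a poly) set) = card ?B"
  proof (rule bij_betw_same_card, rule bij_betw_byWitness[where
        f = "\<lambda>(x :: 'a poly, y :: 'a poly, z). (degree (gcd y z), gcd y z, x, y div gcd y z, z div gcd y z)" and
        f' = "\<lambda>(j :: nat, e :: 'a poly, x :: 'a poly, y, z). (x, e * y, e * z)"])
    show "\<forall>a\<in>monic_triples k. (case case a of (x, y, z) \<Rightarrow> (degree (gcd y z), gcd y z, x, y div gcd y z, z div gcd y z) of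
        (j, e, x, y, z) \<Rightarrow> (x, e * y, e * z)) = (a :: 'a poly \<times> 'a poly \<times> 'a poly)"
      by auto
    show "\<forall>b\<in>?B. (case case b of (j, e, x, y, z) \<Rightarrow> (x, e * y, e * z) of
        (x, y, z) \<Rightarrow> (degree (gcd y z), gcd y z, x, y div gcd y z, z div gcd y z)) = b"
    proof
      fix b assume "b \<in> ?B"
      then obtain j e x y z where b: "b = (j, e, x, y, z)" and e: "lead_coeff e = 1" "degree e = j" and c: "coprime y z"
        by (auto simp: monic_of_degree_def coprime_triples_def)
      have "gcd (e * y) (e * z) = e"
        using c by (simp add: gcd_mult_left normalize_monic[OF e(1)])
      moreover have "e \<noteq> 0" using e by auto
      ultimately show "(case case b of (j, e, x, y, z) \<Rightarrow> (x, e * y, e * z) of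
        (x, y, z) \<Rightarrow> (degree (gcd y z), gcd y z, x, y div gcd y z, z div gcd y z)) = b"
        using e b by simp
    qed
    show "(\<lambda>(x, y, z). (degree (gcd y z), gcd y z, x, y div gcd y z, z div gcd y z)) ` monic_triples k \<subseteq> ?B"
    proof (intro image_subsetI)
      fix a :: "'a poly \<times> 'a poly \<times> 'a poly" assume "a \<in> monic_triples k"
      then obtain x y z where a: "a = (x, y, z)" "lead_coeff x = 1" "lead_coeff y = 1" "lead_coeff z = 1"
        "degree x + degree y + degree z = k" by (auto simp: monic_triples_def)
      define e where "e = gcd y z"
      have nz: "y \<noteq> 0" "z \<noteq> 0" using a by auto
      have e: "lead_coeff e = 1" "e \<noteq> 0" using nz by (auto simp: e_def lead_coeff_gcd)
      obtain u v where uv: "y = e * u" "z = e * v" "coprime u v"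
        unfolding e_def using gcd_coprime_exists[of y z] nz by (metis gcd_eq_0_iff mult.commute)
      have nz': "u \<noteq> 0" "v \<noteq> 0" using nz uv by auto
      have l: "lead_coeff u = 1" "lead_coeff v = 1"
        using a e uv by (auto intro: lead_coeff_divide_monic)
      have "degree x + 2 * degree e + degree u + degree v = k"
        using a(5) e nz' by (simp add: uv degree_mult_eq)
      then have "(degree e, e, x, u, v) \<in> ?B"
        using a e l uv by (auto simp: monic_of_degree_def coprime_triples_def monic_triples_def)
      moreover have "y div e = u" "z div e = v" using e uv by simp_all
      ultimately show "(case a of (x, y, z) \<Rightarrow> (degree (gcd y z), gcd y z, x, y div gcd y z, z div gcd y z)) \<in> ?B"
        using a by (simp flip: e_def)
    qed
    show "(\<lambda>(j, e, x, y, z). (x, e * y, e * z)) ` ?B \<subseteq> monic_triples k"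
    proof (intro image_subsetI)
      fix b assume "b \<in> ?B"
      then obtain j e x y z where b: "b = (j, e, x, y, z)" and e: "lead_coeff e = 1" "degree e = j" "j \<le> k div 2"
        and xyz: "lead_coeff x = 1" "lead_coeff y = 1" "lead_coeff z = 1" "degree x + degree y + degree z = k - 2 * j"
        by (auto simp: monic_of_degree_def coprime_triples_def monic_triples_def)
      have nz: "e \<noteq> 0" "y \<noteq> 0" "z \<noteq> 0" using e xyz by auto
      have "lead_coeff (e * y) = 1" "lead_coeff (e * z) = 1" unfolding lead_coeff_mult using e xyz by simp_all
      moreover have "degree x + degree (e * y) + degree (e * z) = k"
        using nz e xyz by (simp add: degree_mult_eq)
      ultimately show "(case b of (j, e, x, y, z) \<Rightarrow> (x, e * y, e * z)) \<in> monic_triples k"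
        using b xyz by (simp add: monic_triples_def)
    qed
  qed
  also have "\<dots> = (\<Sum>j\<le>k div 2. CARD('a) ^ j * card (coprime_triples (k - 2 * j) :: ('a poly \<times> 'a poly \<times> 'a poly) set))"
    by (simp add: card_SigmaI card_cartesian_product card_monic_of_degree)
  finally show ?thesis .
qed

text \<open>Multiplying that series identity by \<open>1 - q u^2\<close> shows that coprime triples
  number \<open>T k - q * T (k - 2)\<close>, with \<open>T\<close> the count of all triples. The
  subtracted term is the source of the factor \<open>1 - 1/q\<close> in the main term.\<close>

lemma card_coprime_triples:
  "real (card (coprime_triples k :: ('a::{finite,field_gcd} poly \<times> 'a poly \<times> 'a poly) set))
    = (real (k + 1) * real (k + 2) / 2 - real k * (real k - 1) / (2 * real CARD('a))) * real CARD('a) ^ k"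
proof -
  let ?C = "\<lambda>k. card (coprime_triples k :: ('a poly \<times> 'a poly \<times> 'a poly) set)"
  let ?T = "\<lambda>k. card (monic_triples k :: ('a poly \<times> 'a poly \<times> 'a poly) set)"
  have T: "real (?T k) = real (k + 1) * real (k + 2) / 2 * real CARD('a) ^ k" for k
  proof -
    have "2 * real (?T k) = real (k + 1) * real (k + 2) * real CARD('a) ^ k"
      using arg_cong[OF card_monic_triples[where 'a='a, of k], of real]
      by (simp only: of_nat_mult of_nat_power of_nat_numeral)
    then show ?thesis by simp
  qed
  show ?thesis
  proof (cases "k < 2")
    case True
    \<comment> \<open>For \<open>k < 2\<close> nothing is subtracted, in agreement with the factor
      \<open>k * (k - 1)\<close> of the formula.\<close>
    then have "?T k = ?C k" using card_monic_triples_gcd[where 'a='a, of k] by simp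
    then show ?thesis using T[of k] True by (auto simp: less_2_cases_iff)
  next
    case False
    then obtain m where m: "k = m + 2" by (metis add.commute le_Suc_ex not_less)
    have "?T k = (\<Sum>j\<le>Suc (m div 2). CARD('a) ^ j * ?C (k - 2 * j))"
      using card_monic_triples_gcd[where 'a='a, of k] by (simp add: m)
    also have "\<dots> = ?C k + (\<Sum>j\<le>m div 2. CARD('a) ^ Suc j * ?C (k - 2 * Suc j))"
      by (subst sum.atMost_Suc_shift) simp
    also have "(\<Sum>j\<le>m div 2. CARD('a) ^ Suc j * ?C (k - 2 * Suc j)) = CARD('a) * ?T m"
      unfolding card_monic_triples_gcd[where 'a='a, of m] by (simp add: m sum_distrib_left mult_ac)
    finally have "real (?C k) = real (?T k) - real CARD('a) * real (?T m)"
      by simp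
    also have "\<dots> = real (k + 1) * real (k + 2) / 2 * real CARD('a) ^ k
        - real CARD('a) * (real (m + 1) * real (m + 2) / 2 * real CARD('a) ^ m)"
      unfolding T ..
    finally have eq: "real (?C k) = real (k + 1) * real (k + 2) / 2 * (real CARD('a) * real CARD('a) * real CARD('a) ^ m)
        - real CARD('a) * (real (m + 1) * real (m + 2) / 2 * real CARD('a) ^ m)"
      by (simp add: m)
    have alg: "A * (q * q * x) - q * (B / 2 * x) = (A - B / (2 * q)) * (q * q * x)" if "q \<noteq> 0" for A B q x :: real
      using that by (simp add: field_simps)
    note eq
    also have "real (k + 1) * real (k + 2) / 2 * (real CARD('a) * real CARD('a) * real CARD('a) ^ m)
        - real CARD('a) * (real (m + 1) * real (m + 2) / 2 * real CARD('a) ^ m)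
      = (real (k + 1) * real (k + 2) / 2 - real (m + 1) * real (m + 2) / (2 * real CARD('a)))
        * (real CARD('a) * real CARD('a) * real CARD('a) ^ m)" by (rule alg) simp
    also have "real (m + 1) * real (m + 2) = real k * (real k - 1)" by (simp add: m)
    also have "real CARD('a) * real CARD('a) * real CARD('a) ^ m = real CARD('a) ^ k"
      by (simp add: m)
    finally show ?thesis .
  qed
qed

text \<open>After division by \<open>h = gcd f1 f2\<close> the cofactors are coprime with square
  product, so each is a square. Monic normalisation makes the roots, and hence the triple,
  unique.\<close>

lemma card_square_pairs:
  "card {(f1, f2) \<in> (monic_pairs (2 * k) :: ('a::{finite,field_gcd} poly \<times> 'a poly) set). \<exists>w. f1 * f2 = w\<^sup>2}
    = card (coprime_triples k :: ('a poly \<times> 'a poly \<times> 'a poly) set)"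
proof -
  let ?S = "{(f1, f2) \<in> (monic_pairs (2 * k) :: ('a poly \<times> 'a poly) set). \<exists>w. f1 * f2 = w\<^sup>2}"
  let ?F = "\<lambda>(h, u, v). (h * u\<^sup>2, h * v\<^sup>2) :: 'a poly \<times> 'a poly"
  have gcd_F: "gcd (h * u\<^sup>2) (h * v\<^sup>2) = h" if "lead_coeff h = 1" "coprime u v" for h u v :: "'a poly"
    using that by (simp add: gcd_mult_left normalize_monic)
  have unique: "u = u'" if "u\<^sup>2 = u'\<^sup>2" "lead_coeff u = 1" "lead_coeff u' = 1" for u u' :: "'a poly"
  proof -
    have "u dvd u'" "u' dvd u" using that(1) by (metis dvd_refl pow_divides_pow_iff pos2)+
    then have "normalize u = normalize u'" by (simp add: associated_iff_dvd)
    then show ?thesis using that by (simp add: normalize_monic)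
  qed
  have inj: "inj_on ?F (coprime_triples k)"
  proof (rule inj_onI)
    fix s s' assume "s \<in> coprime_triples k" "s' \<in> coprime_triples k" "?F s = ?F s'"
    moreover obtain h u v h' u' v' where s: "s = (h, u, v)" "s' = (h', u', v')"
      by (metis prod_cases3)
    ultimately have t: "(h, u, v) \<in> coprime_triples k" "(h', u', v') \<in> coprime_triples k"
      and eq: "h * u\<^sup>2 = h' * u'\<^sup>2" "h * v\<^sup>2 = h' * v'\<^sup>2"
      by auto
    have l: "lead_coeff h = 1" "lead_coeff u = 1" "lead_coeff v = 1" "coprime u v"
      "lead_coeff h' = 1" "lead_coeff u' = 1" "lead_coeff v' = 1" "coprime u' v'"
      using t by (auto simp: coprime_triples_def monic_triples_def)
    have hh: "h = h'" using gcd_F l eq by metis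
    moreover have "h \<noteq> 0" using l by auto
    ultimately have "u\<^sup>2 = u'\<^sup>2" "v\<^sup>2 = v'\<^sup>2" using eq by auto
    then show "s = s'" using s hh l unique by blast
  qed
  have img: "?F ` coprime_triples k = ?S"
  proof (intro equalityI image_subsetI subsetI)
    fix t :: "'a poly \<times> 'a poly \<times> 'a poly" assume "t \<in> coprime_triples k"
    then obtain h u v where t: "t = (h, u, v)" "lead_coeff h = 1" "lead_coeff u = 1" "lead_coeff v = 1"
      "degree h + degree u + degree v = k"
      by (auto simp: coprime_triples_def monic_triples_def)
    have nz: "h \<noteq> 0" "u \<noteq> 0" "v \<noteq> 0" using t by auto
    have "lead_coeff (h * u\<^sup>2) = 1" "lead_coeff (h * v\<^sup>2) = 1"
      unfolding lead_coeff_mult lead_coeff_power using t by simp_all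
    moreover have "degree (h * u\<^sup>2) + degree (h * v\<^sup>2) = 2 * k"
      using nz t(5) by (simp add: degree_mult_eq degree_power_eq)
    moreover have "(h * u\<^sup>2) * (h * v\<^sup>2) = (h * u * v)\<^sup>2" by (simp add: power2_eq_square mult_ac)
    ultimately show "?F t \<in> ?S" unfolding t(1) by (auto simp: monic_pairs_iff)
  next
    fix p :: "'a poly \<times> 'a poly" assume "p \<in> ?S"
    then obtain f1 f2 w where p: "p = (f1, f2)" "lead_coeff f1 = 1" "lead_coeff f2 = 1"
      "degree f1 + degree f2 = 2 * k" "f1 * f2 = w\<^sup>2" by (auto simp: monic_pairs_iff)
    define h where "h = gcd f1 f2"
    have nz: "f1 \<noteq> 0" "f2 \<noteq> 0" using p by auto
    have h: "lead_coeff h = 1" "h \<noteq> 0" using nz by (auto simp: h_def lead_coeff_gcd)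
    obtain a b where ab: "f1 = h * a" "f2 = h * b" "coprime a b"
      unfolding h_def using gcd_coprime_exists[of f1 f2] nz by (metis gcd_eq_0_iff mult.commute)
    have l: "lead_coeff a = 1" "lead_coeff b = 1"
      using p h ab by (auto intro: lead_coeff_divide_monic)
    have nz': "a \<noteq> 0" "b \<noteq> 0" using l by auto
    have hab: "h\<^sup>2 * (a * b) = w\<^sup>2" using p(5) by (simp add: ab power2_eq_square mult_ac)
    then have "h dvd w" by (metis dvd_triv_left pow_divides_pow_iff pos2)
    then obtain t where "w = h * t" by (rule dvdE)
    then have t: "a * b = t\<^sup>2" using hab h by (simp add: power_mult_distrib)
    \<comment> \<open>An explicit square root: for coprime \<open>x\<close> and \<open>y\<close> the
      square of \<open>gcd x t\<close> is the gcd of \<open>x * x\<close> and \<open>x * y\<close>,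
      which is \<open>x\<close>.\<close>
    have root: "(gcd x t)\<^sup>2 = x" if "x * y = t\<^sup>2" "coprime x y" "lead_coeff x = 1" for x y
    proof -
      have "(gcd x t)\<^sup>2 = gcd (x\<^sup>2) (t\<^sup>2)" by simp
      also have "\<dots> = gcd (x * x) (x * y)" by (simp add: that power2_eq_square)
      also have "\<dots> = x"
        by (simp only: gcd_mult_left normalize_monic[OF that(3)] coprime_imp_gcd_eq_1[OF that(2)] mult_1_right)
      finally show ?thesis .
    qed
    define u where "u = gcd a t"
    define v where "v = gcd b t"
    have uv: "u\<^sup>2 = a" "v\<^sup>2 = b" unfolding u_def v_def
      using root[OF t ab(3) l(1)] root[of b a] t ab(3) l(2) by (simp_all add: mult.commute coprime_commute)
    have "lead_coeff u = 1" "lead_coeff v = 1" using nz' by (simp_all add: u_def v_def lead_coeff_gcd)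
    moreover have "coprime u v" using ab(3) by (simp flip: uv)
    moreover have "degree h + degree u + degree v = k"
    proof -
      have "u \<noteq> 0" "v \<noteq> 0" using uv nz' by auto
      then show ?thesis using p(4) h by (simp add: ab degree_mult_eq degree_power_eq flip: uv)
    qed
    ultimately have "(h, u, v) \<in> coprime_triples k"
      using h by (simp add: coprime_triples_def monic_triples_def)
    moreover have "p = ?F (h, u, v)" by (simp add: p(1) ab uv)
    ultimately show "p \<in> ?F ` coprime_triples k" by (rule rev_image_eqI)
  qed
  show ?thesis using card_image[OF inj] unfolding img .
qed

section \<open>The second moment\<close>

text \<open>With \<open>x = 2 * g + 1\<close> the two cubics are
  \<open>(x + 1) (x + 2) (x + 3)\<close> and \<open>(x - 1) (x - 2) (x - 3)\<close>. Writing them in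
  \<open>x\<close> rather than \<open>g\<close> displays the leading term
  \<open>(1 - 1/q) x^3 / 24\<close>.\<close>

lemma sum_square_pairs_closed_form:
  fixes q :: real
  defines "c \<equiv> \<lambda>j. real (j + 1) * real (j + 2) / 2 - real j * (real j - 1) / (2 * q)"
  shows "(\<Sum>j\<le>g. (if j = g then 1 else 2) * c j) =
    ((real (2*g+1)) ^ 3 + 6 * (real (2*g+1))\<^sup>2 + 11 * real (2*g+1) + 6) / 24
    - ((real (2*g+1)) ^ 3 - 6 * (real (2*g+1))\<^sup>2 + 11 * real (2*g+1) - 6) / (24 * q)"
proof -
  define t where "t = 1 / q"
  have c: "c j = (real j + 1) * (real j + 2) / 2 - t * (real j * (real j - 1) / 2)" for j
    by (simp add: c_def t_def add_ac)
  have part: "(\<Sum>j<g. 2 * c j) = real g * (real g + 1) * (real g + 2) / 3 - t * (real g * (real g - 1) * (real g - 2) / 3)"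
  proof (induction g)
    case (Suc g)
    show ?case unfolding sum.lessThan_Suc Suc.IH c[of g] of_nat_Suc
      by (simp add: field_simps)
  qed simp
  have "(\<Sum>j\<le>g. (if j = g then 1 else 2) * c j) = (\<Sum>j<g. 2 * c j) + c g"
    by (simp flip: lessThan_Suc_atMost)
  also have "\<dots> = ((2 * real g + 1) ^ 3 + 6 * (2 * real g + 1)\<^sup>2 + 11 * (2 * real g + 1) + 6) / 24
    - t * (((2 * real g + 1) ^ 3 - 6 * (2 * real g + 1)\<^sup>2 + 11 * (2 * real g + 1) - 6) / 24)"
    unfolding part c[of g] by (simp add: field_simps power2_eq_square power3_eq_cube)
  also have "2 * real g + 1 = real (2*g+1)" by simp
  finally show ?thesis by (simp add: t_def)
qed

lemma sum_powers_le:
  fixes s :: real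
  assumes "s \<ge> 2" shows "(\<Sum>k\<le>n. s ^ k) \<le> 2 * s ^ n"
proof (induction n)
  case (Suc n)
  have "2 * s ^ n \<le> s * s ^ n" using assms by (intro mult_right_mono) auto
  then show ?case using Suc by simp
qed simp

text \<open>
  To be used with \<open>x = 2g + 1\<close>, \<open>Q = q\<^sup>x\<close>, \<open>\<pi>\<close> the number of primes of degree \<open>x\<close> and \<open>R = q\<^bsup>g+1\<^esup>\<close>.
\<close>

lemma main_term_error:
  fixes x Q q \<pi> M R :: real
  assumes q: "q \<ge> 1" and x: "x \<ge> 1" and Q: "R * x \<le> Q" "0 \<le> R"
    and \<pi>: "x * \<pi> \<le> Q" "Q \<le> x * \<pi> + R"
    and M: "M = (x ^ 3 + 6 * x\<^sup>2 + 11 * x + 6) / 24 - (x ^ 3 - 6 * x\<^sup>2 + 11 * x - 6) / (24 * q)"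
  shows "\<bar>\<pi> * M - 1 / 24 * (1 - 1 / q) * Q * x\<^sup>2\<bar> \<le> 5 * (Q * x)"
proof -
  define t where "t = 1 / q"
  have t: "0 \<le> t" "t \<le> 1" using q by (simp_all add: t_def)
  have "M = (x ^ 3 + 6 * x\<^sup>2 + 11 * x + 6) / 24 - t * ((x ^ 3 - 6 * x\<^sup>2 + 11 * x - 6) / 24)"
    unfolding M t_def by simp
  moreover define E where "E = (1 + t) * x\<^sup>2 / 4 + (1 - t) * (11 * x) / 24 + (1 + t) / 4"
  ultimately have M_eq: "M = (1 - t) * x ^ 3 / 24 + E" by (simp add: field_simps)
  have xx: "x \<le> x\<^sup>2" "1 \<le> x\<^sup>2" "x\<^sup>2 \<le> x ^ 3" using x by (simp_all add: self_le_power power_increasing)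
  have E0: "0 \<le> E" using t x by (simp add: E_def)
  have E: "E \<le> 2 * x\<^sup>2"
  proof -
    have "(1 + t) * x\<^sup>2 \<le> 2 * x\<^sup>2" "(1 - t) * (11 * x) \<le> 1 * (11 * x)" using t x by (intro mult_right_mono; simp)+
    then have "(1 + t) * x\<^sup>2 / 4 \<le> x\<^sup>2 / 2" "(1 - t) * (11 * x) / 24 \<le> 11 * x / 24" by (simp_all add: mult.commute)
    moreover have "(1 + t) / 4 \<le> 1 / 2" using t by simp
    ultimately show ?thesis unfolding E_def using xx by linarith
  qed
  have M0: "0 \<le> M" using M_eq E0 t x by simp
  have M3: "M \<le> 3 * x ^ 3"
  proof -
    have "(1 - t) * x ^ 3 \<le> 1 * x ^ 3" using t x by (intro mult_right_mono) auto
    then show ?thesis using M_eq E xx by simp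
  qed
  have Q0: "Q \<ge> 0" using Q x by (meson dual_order.trans mult_nonneg_nonneg order_trans zero_le_one)
  define \<delta> where "\<delta> = Q - x * \<pi>"
  have \<delta>: "0 \<le> \<delta>" "\<delta> \<le> R" using \<pi> by (simp_all add: \<delta>_def)
  \<comment> \<open>Multiplying by \<open>x\<close> allows \<pi> to be replaced through
    \<open>x * \<pi> = Q - \<delta>\<close>, and the cubic part of \<open>M\<close> cancels. The
    final 5 is 2 from the bound for \<open>E\<close> plus 3 from that for \<open>M\<close>.\<close>
  have eq: "x * (\<pi> * M - 1 / 24 * (1 - 1 / q) * Q * x\<^sup>2) = Q * E - \<delta> * M"
    unfolding \<delta>_def M_eq t_def[symmetric] by (simp add: field_simps power2_eq_square power3_eq_cube)
  have QE: "0 \<le> Q * E" "Q * E \<le> Q * (2 * x\<^sup>2)"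
    using Q0 E0 E by (auto intro: mult_left_mono)
  have "\<delta> * M \<le> R * (3 * x ^ 3)" using \<delta> M0 M3 by (intro mult_mono) auto
  also have "\<dots> = (R * x) * (3 * x\<^sup>2)" by (simp add: power2_eq_square power3_eq_cube)
  also have "\<dots> \<le> Q * (3 * x\<^sup>2)" using Q by (intro mult_right_mono) auto
  finally have \<delta>M: "\<delta> * M \<le> Q * (3 * x\<^sup>2)" .
  have "0 \<le> \<delta> * M" using \<delta> M0 by simp
  then have "\<bar>x * (\<pi> * M - 1 / 24 * (1 - 1 / q) * Q * x\<^sup>2)\<bar> \<le> Q * (2 * x\<^sup>2) + Q * (3 * x\<^sup>2)"
    unfolding eq using QE \<delta>M by (simp only: abs_le_iff) linarith
  also have "\<dots> = x * (5 * (Q * x))" by (simp add: power2_eq_square)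
  finally show ?thesis using x by (simp add: abs_mult)
qed

text \<open>The constant 21 consists of 16 for the nonsquare pairs and 5 for the main term.\<close>

lemma second_moment_estimate:
  assumes q: "CARD('a::{finite,field_gcd}) mod 4 = 1" and g: "g > 0"
  shows "\<bar>(\<Sum>P\<in>(monic_irreducibles_of_degree (2*g+1) :: 'a poly set). (L_half P)\<^sup>2)
      - 1 / 24 * (1 - 1 / real CARD('a)) * real CARD('a) ^ (2*g+1) * (real (2*g+1))\<^sup>2\<bar>
    \<le> 21 * (real CARD('a) ^ (2*g+1) * real (2*g+1))"
proof -
  let ?q = "CARD('a)" and ?M = "monic_irreducibles_of_degree (2 * g + 1) :: 'a poly set"
  have odd: "odd ?q" using q by presburger
  \<comment> \<open>This puts \<open>sqrt q\<close> above 2, so the geometric sum in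
    \<open>s\<close> is at most twice its last term.\<close>
  have q5: "?q \<ge> 5" using card_ge_3[OF odd] q by (cases "?q = 3 \<or> ?q = 4") auto
  define s where "s = sqrt (real ?q)"
  have s2: "s\<^sup>2 = real ?q" by (simp add: s_def)
  have s: "s \<ge> 2" unfolding s_def using q5 by (intro real_le_rsqrt) simp
  have qq: "real ?q ^ (2 * g + 1) = real ?q ^ (g + 1) * real ?q ^ g"
  proof -
    have "2 * g + 1 = (g + 1) + g" by simp
    then show ?thesis by (simp only: power_add)
  qed
  define w :: "nat \<Rightarrow> real" where "w k = (if k = 2 * g then 1 else 2) / s ^ k" for k
  define S where "S f = (\<Sum>P\<in>?M. real_of_int (qr_symbol f P))" for f
  define Sq where "Sq k = {(f1, f2) \<in> (monic_pairs k :: ('a poly \<times> 'a poly) set). \<exists>w. f1 * f2 = w\<^sup>2}" for k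
  have fin: "finite (Sq k)" for k
    by (rule finite_subset[OF _ finite_monic_pairs[of k]]) (auto simp: Sq_def)
  have X_square: "S (f1 * f2) = card ?M" if "(f1, f2) \<in> Sq k" "k \<le> 2 * g" for f1 f2 k
  proof -
    obtain w where w: "f1 * f2 = w\<^sup>2" and pair: "(f1, f2) \<in> monic_pairs k" using \<open>(f1, f2) \<in> Sq k\<close> by (auto simp: Sq_def)
    have nz: "f1 \<noteq> 0" "f2 \<noteq> 0" and deg: "degree f1 + degree f2 = k" using pair by (auto simp: monic_pairs_iff)
    have "qr_symbol (f1 * f2) P = 1" if P: "P \<in> ?M" for P
    proof -
      \<comment> \<open>Truncation at total degree \<open>2 * g\<close> keeps the product below the
        degree of \<open>P\<close>, so no symbol is 0 and each square pair contributes the full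
        number of primes.\<close>
      have "degree (f1 * f2) < degree P" using P nz deg \<open>k \<le> 2 * g\<close>
        by (simp add: degree_mult_eq monic_irreducibles_of_degree_def)
      then have "\<not> P dvd f1 * f2" using nz dvd_imp_degree_le[of P "f1 * f2"] by auto
      then show ?thesis using w by (auto simp: qr_symbol_def intro!: exI[of _ w])
    qed
    then show ?thesis by (simp add: S_def)
  qed
  have X_nonsquare: "\<bar>S (f1 * f2)\<bar> \<le> 4 * real ?q ^ (g + 1)"
    if "(f1, f2) \<in> monic_pairs k - Sq k" "k \<le> 2 * g" for f1 f2 k
  proof -
    have pair: "lead_coeff f1 = 1" "lead_coeff f2 = 1" "degree f1 + degree f2 = k" "\<nexists>w. f1 * f2 = w\<^sup>2"
      using that by (auto simp: Sq_def monic_pairs_iff)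
    have "degree (f1 * f2) \<le> 2 * g" using degree_mult_le[of f1 f2] pair that by linarith
    moreover have "lead_coeff (f1 * f2) = 1" unfolding lead_coeff_mult using pair by simp
    ultimately have "\<bar>\<Sum>P\<in>?M. qr_symbol (f1 * f2) P\<bar> \<le> 4 * int ?q ^ (g + 1)"
      using odd g pair(4) by (intro prime_character_sum_bound)
    then have "real_of_int \<bar>\<Sum>P\<in>?M. qr_symbol (f1 * f2) P\<bar> \<le> real_of_int (4 * int ?q ^ (g + 1))"
      by (simp only: of_int_le_iff)
    then show ?thesis by (simp add: S_def)
  qed
  define N where "N k = (\<Sum>(f1, f2)\<in>monic_pairs k - Sq k. S (f1 * f2))" for k
  have "(\<Sum>P\<in>?M. (L_half P)\<^sup>2) = (\<Sum>P\<in>?M. \<Sum>k\<le>2*g. w k * (\<Sum>(f1, f2)\<in>monic_pairs k. real_of_int (qr_symbol (f1 * f2) P)))"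
    by (intro sum.cong) (simp_all add: L_half_square[OF q] w_def s_def)
  also have "\<dots> = (\<Sum>k\<le>2*g. w k * (\<Sum>(f1, f2)\<in>monic_pairs k. S (f1 * f2)))"
    unfolding S_def case_prod_unfold
    by (subst sum.swap, intro sum.cong refl) (simp flip: sum_distrib_left, subst sum.swap, simp)
  also have "\<dots> = (\<Sum>k\<le>2*g. w k * (real (card (Sq k)) * card ?M + N k))"
  proof (intro sum.cong refl arg_cong[where f = "(*) _"])
    fix k assume k: "k \<in> {..2*g}"
    have sub: "Sq k \<subseteq> monic_pairs k" by (auto simp: Sq_def)
    have "(\<Sum>(f1, f2)\<in>monic_pairs k. S (f1 * f2)) = N k + (\<Sum>(f1, f2)\<in>Sq k. S (f1 * f2))"
      unfolding N_def by (rule sum.subset_diff[OF sub]) simp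
    also have "(\<Sum>(f1, f2)\<in>Sq k. S (f1 * f2)) = (\<Sum>p\<in>Sq k. real (card ?M))"
      by (rule sum.cong) (use X_square k in auto)
    finally show "(\<Sum>(f1, f2)\<in>monic_pairs k. S (f1 * f2)) = real (card (Sq k)) * card ?M + N k" by simp
  qed
  also have "\<dots> = card ?M * (\<Sum>k\<le>2*g. w k * card (Sq k)) + (\<Sum>k\<le>2*g. w k * N k)"
    by (simp add: distrib_left sum.distrib sum_distrib_left mult_ac)
  finally have split: "(\<Sum>P\<in>?M. (L_half P)\<^sup>2) = card ?M * (\<Sum>k\<le>2*g. w k * card (Sq k)) + (\<Sum>k\<le>2*g. w k * N k)" .

  \<comment> \<open>The last term dominates: at \<open>k = 2 * g\<close> the count
    \<open>(k + 1) q^k\<close> times the weight \<open>q^(-k/2)\<close> is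
    \<open>(2 * g + 1) q^g\<close>. The 16 is 4 from the prime sums, 2 from the weight and 2 from
    the geometric sum.\<close>
  have N_bound: "\<bar>\<Sum>k\<le>2*g. w k * N k\<bar> \<le> 16 * (real ?q ^ (2*g+1) * real (2*g+1))"
  proof -
    have "\<bar>w k * N k\<bar> \<le> 8 * real ?q ^ (g + 1) * real (2*g+1) * s ^ k" if k: "k \<in> {..2*g}" for k
    proof -
      have "\<bar>N k\<bar> \<le> (\<Sum>p\<in>monic_pairs k - Sq k. 4 * real ?q ^ (g + 1))"
        unfolding N_def by (rule order_trans[OF sum_abs sum_mono]) (use X_nonsquare k in auto)
      also have "\<dots> \<le> (\<Sum>p\<in>(monic_pairs k :: ('a poly \<times> 'a poly) set). 4 * real ?q ^ (g + 1))"
        by (rule sum_mono2) auto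
      also have "\<dots> = (real k + 1) * s ^ k * s ^ k * (4 * real ?q ^ (g + 1))"
      proof -
        have "real ?q ^ k = s ^ k * s ^ k" unfolding s2[symmetric] by (simp add: power2_eq_square power_mult_distrib)
        then have "real (card (monic_pairs k :: ('a poly \<times> 'a poly) set)) = (real k + 1) * s ^ k * s ^ k"
          unfolding card_monic_pairs by (simp add: algebra_simps)
        then show ?thesis by (simp only: sum_constant)
      qed
      also have "\<dots> \<le> real (2*g+1) * s ^ k * s ^ k * (4 * real ?q ^ (g + 1))"
        using k s by (intro mult_right_mono) auto
      finally have Nk: "\<bar>N k\<bar> \<le> real (2*g+1) * s ^ k * s ^ k * (4 * real ?q ^ (g + 1))" .
      have "\<bar>w k\<bar> \<le> 2 / s ^ k" using s by (simp add: w_def divide_right_mono)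
      then have "\<bar>w k * N k\<bar> \<le> 2 / s ^ k * (real (2*g+1) * s ^ k * s ^ k * (4 * real ?q ^ (g + 1)))"
        unfolding abs_mult using Nk s by (intro mult_mono) auto
      also have "\<dots> = 8 * real ?q ^ (g + 1) * real (2*g+1) * s ^ k" using s by (simp add: field_simps)
      finally show ?thesis .
    qed
    then have "\<bar>\<Sum>k\<le>2*g. w k * N k\<bar> \<le> (\<Sum>k\<le>2*g. 8 * real ?q ^ (g + 1) * real (2*g+1) * s ^ k)"
      by (rule order_trans[OF sum_abs sum_mono])
    also have "\<dots> = 8 * real ?q ^ (g + 1) * real (2*g+1) * (\<Sum>k\<le>2*g. s ^ k)"
      by (simp only: sum_distrib_left)
    also have "\<dots> \<le> 8 * real ?q ^ (g + 1) * real (2*g+1) * (2 * s ^ (2*g))"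
      by (intro mult_left_mono sum_powers_le s) auto
    also have "\<dots> = 16 * (real ?q ^ (2*g+1) * real (2*g+1))"
      unfolding power_mult s2 qq by (simp only: mult_ac)
    finally show ?thesis .
  qed

  define M where "M = (\<Sum>k\<le>2*g. w k * card (Sq k))"
  define c where "c j = real (j + 1) * real (j + 2) / 2 - real j * (real j - 1) / (2 * real ?q)" for j
  have "M = (\<Sum>k\<in>(\<lambda>j. 2 * j) ` {..g}. w k * card (Sq k))"
    unfolding M_def
  proof (rule sum.mono_neutral_right)
    show "\<forall>k\<in>{..2*g} - (\<lambda>j. 2 * j) ` {..g}. w k * card (Sq k) = 0"
    proof
      fix k assume k: "k \<in> {..2*g} - (\<lambda>j. 2 * j) ` {..g}"
      have "Sq k = {}"
      proof (rule ccontr)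
        assume "Sq k \<noteq> {}"
        then obtain f1 f2 w :: "'a poly" where p: "(f1, f2) \<in> monic_pairs k" "f1 * f2 = w\<^sup>2" by (auto simp: Sq_def)
        then have nz: "f1 \<noteq> 0" "f2 \<noteq> 0" by (auto simp: monic_pairs_iff)
        then have "w \<noteq> 0" using p by auto
        have "k = degree (f1 * f2)" using p(1) nz by (simp add: monic_pairs_iff degree_mult_eq)
        also have "\<dots> = 2 * degree w" using \<open>w \<noteq> 0\<close> p by (simp add: degree_power_eq)
        finally show False using k by auto
      qed
      then show "w k * card (Sq k) = 0" by simp
    qed
  qed auto
  also have "\<dots> = (\<Sum>j\<le>g. w (2 * j) * card (Sq (2 * j)))"
    by (subst sum.reindex) (auto simp: inj_on_def)
  also have "\<dots> = (\<Sum>j\<le>g. (if j = g then 1 else 2) * c j)"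
  proof (rule sum.cong[OF refl])
    fix j
    have "real (card (Sq (2 * j))) = c j * real ?q ^ j"
      unfolding Sq_def card_square_pairs card_coprime_triples c_def ..
    moreover have "w (2 * j) = (if j = g then 1 else 2) / real ?q ^ j"
      by (simp add: w_def power_mult s2)
    ultimately show "w (2 * j) * card (Sq (2 * j)) = (if j = g then 1 else 2) * c j" using q5 by simp
  qed
  also have "\<dots> = ((real (2*g+1)) ^ 3 + 6 * (real (2*g+1))\<^sup>2 + 11 * real (2*g+1) + 6) / 24
    - ((real (2*g+1)) ^ 3 - 6 * (real (2*g+1))\<^sup>2 + 11 * real (2*g+1) - 6) / (24 * real ?q)"
    unfolding c_def by (rule sum_square_pairs_closed_form)
  finally have M: "M = \<dots>" .

  have "\<bar>card ?M * M - 1 / 24 * (1 - 1 / real ?q) * real ?q ^ (2*g+1) * (real (2*g+1))\<^sup>2\<bar>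
      \<le> 5 * (real ?q ^ (2*g+1) * real (2*g+1))"
  proof (rule main_term_error[OF _ _ _ _ _ _ M])
    show "real ?q ^ (g + 1) * real (2*g+1) \<le> real ?q ^ (2*g+1)"
    proof -
      have "2 * n + 1 \<le> 3 ^ n" for n :: nat by (induction n) auto
      then have "2 * g + 1 \<le> 3 ^ g" .
      also have "\<dots> \<le> ?q ^ g" using q5 by (intro power_mono) auto
      finally have "real (2 * g + 1) \<le> real (?q ^ g)" by (simp only: of_nat_le_iff)
      then have "real ?q ^ (g + 1) * real (2*g+1) \<le> real ?q ^ (g + 1) * real ?q ^ g"
        by (intro mult_left_mono) auto
      then show ?thesis by (simp only: qq)
    qed
    have "real ((2*g+1) * card ?M) \<le> real (?q ^ (2*g+1))"
      using prime_count_le[where 'a='a, of "2*g+1"] by (simp only: of_nat_le_iff)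
    then show "real (2*g+1) * real (card ?M) \<le> real ?q ^ (2*g+1)" by (simp only: of_nat_mult of_nat_power)
    have "real (?q ^ (2*g+1)) \<le> real ((2*g+1) * card ?M + ?q ^ (g+1))"
      using prime_count_ge[OF odd, of g] by (simp only: of_nat_le_iff)
    then show "real ?q ^ (2*g+1) \<le> real (2*g+1) * real (card ?M) + real ?q ^ (g+1)" by (simp only: of_nat_mult of_nat_add of_nat_power)
  qed (use q5 in auto)
  then show ?thesis using N_bound unfolding split M_def by linarith
qed

theorem theorem2p5:
  assumes "odd CARD('a::{finite,field_gcd})" and "CARD('a) mod 4 = 1"
  shows "(\<lambda>g::nat.
            (\<Sum>P\<in>(monic_irreducibles_of_degree (2*g+1) :: 'a poly set). (L_half P)\<^sup>2)
            - (1/24) * (1 / zeta_A CARD('a) 2) * real CARD('a) ^ (2*g+1) * (real (2*g+1))\<^sup>2)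
         \<in> O(\<lambda>g. real CARD('a) ^ (2*g+1) * real (2*g+1))"
proof (rule bigoI)
  have zeta: "1 / zeta_A CARD('a) 2 = 1 - 1 / real CARD('a)"
    by (simp add: zeta_A_def powr_minus_divide)
  show "\<forall>\<^sub>F g in at_top. norm ((\<Sum>P\<in>(monic_irreducibles_of_degree (2*g+1) :: 'a poly set). (L_half P)\<^sup>2)
            - (1/24) * (1 / zeta_A CARD('a) 2) * real CARD('a) ^ (2*g+1) * (real (2*g+1))\<^sup>2)
      \<le> 21 * norm (real CARD('a) ^ (2*g+1) * real (2*g+1))"
    using eventually_gt_at_top[of 0]
  proof eventually_elim
    case (elim g)
    then show ?case
      unfolding zeta using second_moment_estimate[OF assms(2) elim] by (simp add: abs_mult)
  qed
qed

end
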